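(* Let $G$ and $H$ be ample groupoids whose unit spaces $G^{(0)}$ and $H^{(0)}$ are $\sigma$-compact. Then $G$ and $H$ are groupoid equivalent if and only if $G\times\mathcal{R}\cong H\times\mathcal{R}$ as topological groupoids.
   Context: An ample groupoid is a groupoid $G$ with a topology having a basis of compact open sets, such that inversion and composition are continuous, the unit space $G^{(0)}$ is Hausdorff, and the range and source maps $r,s:G\to G^{(0)}$ are local homeomorphisms. $G$ is not assumed Hausdorff or second countable. Isomorphism of ample groupoids means a groupoid isomorphism that is a homeomorphism. A space is $\sigma$-compact if it has a countable cover by compact sets. $\mathcal{R}=\mathbb{N}\times\mathbb{N}$ is the full equivalence relation on $\mathbb{N}$, regarded as a discrete principal groupoid with unit space $\mathbb{N}$: $r(i,j)=i$, $s(i,j)=j$, $(i,j)(j,k)=(i,k)$, $(i,j)^{-1}=(j,i)$. For an ample groupoid $G$, $G\times\mathcal{R}$ is the ample groupoid with product topology and coordinatewise operations. For ample groupoids $G,H$, a $G$--$H$ equivalence is a topological space $Z$ with commuting free and proper continuous actions of $G$ on the left and $H$ on the right (with continuous anchor maps $r:Z\to G^{(0)}$ and $s:Z\to H^{(0)}$) such that $r$ induces a homeomorphism $Z/H\cong G^{(0)}$ and $s$ induces a homeomorphism $G\backslash Z\cong H^{(0)}$. An action of $G$ on $Z$ is free if $g\cdot z=z$ implies $g$ is a unit, and proper if the map $(g,z)\mapsto(g\cdot z,z)$ from $\{(g,z)\in G\times Z:s(g)=r(z)\}$ to $Z\times Z$ is proper (closed with compact fibres); similarly for right actions. $G$ and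 $H$ are groupoid equivalent if a $G$--$H$ equivalence exists. *)

theory Defs
  imports "HOL-Analysis.Analysis"
begin

section \<open>Topological preliminaries\<close>

definition local_homeomorphism :: "'a topology \<Rightarrow> 'b topology \<Rightarrow> ('a \<Rightarrow> 'b) \<Rightarrow> bool" where
  "local_homeomorphism X Y f \<longleftrightarrow>
     (\<forall>x \<in> topspace X. \<exists>U. openin X U \<and> x \<in> U \<and> openin Y (f ` U) \<and>
        homeomorphic_map (subtopology X U) (subtopology Y (f ` U)) f)"

definition has_compact_open_basis :: "'a topology \<Rightarrow> bool" where
  "has_compact_open_basis X \<longleftrightarrow>
     (\<exists>\<B>. (\<forall>B \<in> \<B>. openin X B \<and> compactin X B) \<and>
          (\<forall>U. openin X U \<longrightarrow> (\<exists>\<U> \<subseteq> \<B>. U = \<Union>\<U>)))"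

definition sigma_compact_space :: "'a topology \<Rightarrow> bool" where
  "sigma_compact_space X \<longleftrightarrow>
     (\<exists>\<K>. countable \<K> \<and> (\<forall>K \<in> \<K>. compactin X K) \<and> \<Union>\<K> = topspace X)"

definition quotient_topology :: "'a topology \<Rightarrow> ('a \<Rightarrow> 'b) \<Rightarrow> 'b topology" where
  "quotient_topology X q =
     topology (\<lambda>U. U \<subseteq> q ` topspace X \<and> openin X {x \<in> topspace X. q x \<in> U})"

lemma openin_quotient_topology:
  "openin (quotient_topology X q) U \<longleftrightarrow>
     U \<subseteq> q ` topspace X \<and> openin X {x \<in> topspace X. q x \<in> U}"
proof -
  have int: "{x \<in> topspace X. q x \<in> S \<inter> T}
      = {x \<in> topspace X. q x \<in> S} \<inter> {x \<in> topspace X. q x \<in> T}" for S T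
    by blast
  have un: "{x \<in> topspace X. q x \<in> \<Union>\<K>} = (\<Union>K\<in>\<K>. {x \<in> topspace X. q x \<in> K})" for \<K>
    by blast
  have "istopology (\<lambda>U. U \<subseteq> q ` topspace X \<and> openin X {x \<in> topspace X. q x \<in> U})"
    unfolding istopology_def int un by (intro conjI allI impI openin_Int openin_Union) auto
  then show ?thesis
    by (simp add: quotient_topology_def topology_inverse')
qed

lemma topspace_quotient_topology [simp]:
  "topspace (quotient_topology X q) = q ` topspace X"
proof -
  have "{x \<in> topspace X. q x \<in> q ` topspace X} = topspace X" by blast
  then have "openin (quotient_topology X q) (q ` topspace X)"
    by (simp add: openin_quotient_topology)
  then have "q ` topspace X \<subseteq> topspace (quotient_topology X q)"
    by (rule openin_subset)
  moreover have "topspace (quotient_topology X q) \<subseteq> q ` topspace X"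
    using openin_topspace[of "quotient_topology X q"] unfolding openin_quotient_topology by (rule conjunct1)
  ultimately show ?thesis by (rule subset_antisym[rotated])
qed

lemma quotient_map_quotient_topology: "quotient_map X (quotient_topology X q) q"
  by (simp add: quotient_map_def openin_quotient_topology)

definition induces_homeomorphism ::
    "'a topology \<Rightarrow> ('a \<Rightarrow> 'b) \<Rightarrow> 'c topology \<Rightarrow> ('a \<Rightarrow> 'c) \<Rightarrow> bool" where
  "induces_homeomorphism X q Y p \<longleftrightarrow>
     (\<exists>f. homeomorphic_map (quotient_topology X q) Y f \<and> (\<forall>x \<in> topspace X. f (q x) = p x))"

lemma induces_homeomorphism_iff:
  "induces_homeomorphism X q Y p \<longleftrightarrow>
     quotient_map X Y p \<and> (\<forall>x \<in> topspace X. \<forall>y \<in> topspace X. p x = p y \<longleftrightarrow> q x = q y)"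
    (is "?L \<longleftrightarrow> ?R")
proof
  assume ?L
  then obtain f where "homeomorphic_map (quotient_topology X q) Y f \<and>
      (\<forall>x \<in> topspace X. f (q x) = p x)"
    unfolding induces_homeomorphism_def ..
  then have f: "homeomorphic_map (quotient_topology X q) Y f"
      "\<And>x. x \<in> topspace X \<Longrightarrow> f (q x) = p x"
    by simp_all
  have "quotient_map X Y (f \<circ> q)"
    by (rule quotient_map_compose[OF quotient_map_quotient_topology])
      (use f(1) in \<open>simp add: homeomorphic_map_def\<close>)
  then have "quotient_map X Y p"
    by (rule quotient_map_eq) (simp add: f(2))
  moreover have "p x = p y \<longleftrightarrow> q x = q y" if "x \<in> topspace X" "y \<in> topspace X" for x y
  proof -
    have "f (q x) = f (q y) \<longleftrightarrow> q x = q y"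
      using homeomorphic_imp_injective_map[OF f(1)] that by (intro inj_on_eq_iff) auto
    then show ?thesis by (simp add: f(2) that)
  qed
  ultimately show ?R by simp
next
  assume R: ?R
  then have Q: "quotient_map X Y p" ..
  have P: "p x = p y \<longleftrightarrow> q x = q y" if "x \<in> topspace X" "y \<in> topspace X" for x y
    using R that by simp
  define f where "f c = p (SOME x. x \<in> topspace X \<and> q x = c)" for c
  have f: "f (q x) = p x" if "x \<in> topspace X" for x
  proof -
    have "(SOME y. y \<in> topspace X \<and> q y = q x) \<in> topspace X \<and>
        q (SOME y. y \<in> topspace X \<and> q y = q x) = q x"
      by (rule someI[where x = x]) (simp add: that)
    then show ?thesis
      using P[of "SOME y. y \<in> topspace X \<and> q y = q x" x] that unfolding f_def by simp
  qed
  have inj: "inj_on f (topspace (quotient_topology X q))"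
    by (rule inj_onI) (auto simp: f P)
  have *: "quotient_map X Y (f \<circ> q)"
    by (rule quotient_map_eq[OF Q]) (simp add: f)
  have "continuous_map (quotient_topology X q) Y f"
    using continuous_compose_quotient_map[OF quotient_map_quotient_topology
        quotient_imp_continuous_map[OF *]] .
  then have "quotient_map (quotient_topology X q) Y f"
    by (rule quotient_map_from_composition
        [OF quotient_imp_continuous_map[OF quotient_map_quotient_topology] _ *])
  then show ?L
    unfolding induces_homeomorphism_def homeomorphic_map_def using inj f by (intro exI[of _ f]) simp
qed


section \<open>Ample groupoids\<close>

text \<open>The unit space is regarded as a subset of the arrow space, which is \<open>topspace (gtop G)\<close>.
  The product \<open>gmult G g h\<close> is meaningful only if \<open>gsource G g = grange G h\<close>.\<close>

record 'a top_groupoid =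
  gtop :: "'a topology"
  grange :: "'a \<Rightarrow> 'a"
  gsource :: "'a \<Rightarrow> 'a"
  gmult :: "'a \<Rightarrow> 'a \<Rightarrow> 'a"
  ginv :: "'a \<Rightarrow> 'a"

definition arrows :: "'a top_groupoid \<Rightarrow> 'a set" where
  "arrows G = topspace (gtop G)"

definition units :: "'a top_groupoid \<Rightarrow> 'a set" where
  "units G = grange G ` arrows G"

definition unit_space :: "'a top_groupoid \<Rightarrow> 'a topology" where
  "unit_space G = subtopology (gtop G) (units G)"

definition composable :: "'a top_groupoid \<Rightarrow> ('a \<times> 'a) set" where
  "composable G = {(g, h). g \<in> arrows G \<and> h \<in> arrows G \<and> gsource G g = grange G h}"

locale groupoid =
  fixes G :: "'a top_groupoid"
  assumes range_closed: "g \<in> arrows G \<Longrightarrow> grange G g \<in> arrows G"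
    and source_closed: "g \<in> arrows G \<Longrightarrow> gsource G g \<in> arrows G"
    and range_range: "g \<in> arrows G \<Longrightarrow> grange G (grange G g) = grange G g"
    and source_range: "g \<in> arrows G \<Longrightarrow> gsource G (grange G g) = grange G g"
    and range_source: "g \<in> arrows G \<Longrightarrow> grange G (gsource G g) = gsource G g"
    and source_source: "g \<in> arrows G \<Longrightarrow> gsource G (gsource G g) = gsource G g"
    and mult_closed: "(g, h) \<in> composable G \<Longrightarrow> gmult G g h \<in> arrows G"
    and range_mult: "(g, h) \<in> composable G \<Longrightarrow> grange G (gmult G g h) = grange G g"
    and source_mult: "(g, h) \<in> composable G \<Longrightarrow> gsource G (gmult G g h) = gsource G h"
    and mult_assoc: "(g, h) \<in> composable G \<Longrightarrow> (h, k) \<in> composable G \<Longrightarrow>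
          gmult G (gmult G g h) k = gmult G g (gmult G h k)"
    and range_mult_left: "g \<in> arrows G \<Longrightarrow> gmult G (grange G g) g = g"
    and source_mult_right: "g \<in> arrows G \<Longrightarrow> gmult G g (gsource G g) = g"
    and inv_closed: "g \<in> arrows G \<Longrightarrow> ginv G g \<in> arrows G"
    and range_inv: "g \<in> arrows G \<Longrightarrow> grange G (ginv G g) = gsource G g"
    and source_inv: "g \<in> arrows G \<Longrightarrow> gsource G (ginv G g) = grange G g"
    and mult_inv_right: "g \<in> arrows G \<Longrightarrow> gmult G g (ginv G g) = grange G g"
    and mult_inv_left: "g \<in> arrows G \<Longrightarrow> gmult G (ginv G g) g = gsource G g"

locale ample_groupoid = groupoid G for G :: "'a top_groupoid" +
  assumes compact_open_basis: "has_compact_open_basis (gtop G)"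
    and continuous_inv: "continuous_map (gtop G) (gtop G) (ginv G)"
    and continuous_mult:
      "continuous_map (subtopology (prod_topology (gtop G) (gtop G)) (composable G)) (gtop G)
         (\<lambda>(g, h). gmult G g h)"
    and Hausdorff_unit_space: "Hausdorff_space (unit_space G)"
    and local_homeomorphism_range: "local_homeomorphism (gtop G) (unit_space G) (grange G)"
    and local_homeomorphism_source: "local_homeomorphism (gtop G) (unit_space G) (gsource G)"

definition groupoid_isomorphism ::
    "'a top_groupoid \<Rightarrow> 'b top_groupoid \<Rightarrow> ('a \<Rightarrow> 'b) \<Rightarrow> bool" where
  "groupoid_isomorphism G H f \<longleftrightarrow>
     homeomorphic_map (gtop G) (gtop H) f \<and>
     (\<forall>g \<in> arrows G. f (grange G g) = grange H (f g) \<and> f (gsource G g) = gsource H (f g)) \<and>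
     (\<forall>(g, h) \<in> composable G. f (gmult G g h) = gmult H (f g) (f h))"

definition groupoid_isomorphic :: "'a top_groupoid \<Rightarrow> 'b top_groupoid \<Rightarrow> bool" where
  "groupoid_isomorphic G H \<longleftrightarrow> (\<exists>f. groupoid_isomorphism G H f)"

text \<open>The unit space \<open>\<nat>\<close> of the full equivalence relation is identified with the diagonal.\<close>

definition full_relation :: "(nat \<times> nat) top_groupoid" where
  "full_relation =
     \<lparr> gtop = discrete_topology UNIV,
       grange = (\<lambda>(i, j). (i, i)),
       gsource = (\<lambda>(i, j). (j, j)),
       gmult = (\<lambda>(i, j) (k, l). (i, l)),
       ginv = (\<lambda>(i, j). (j, i)) \<rparr>"

definition prod_groupoid ::
    "'a top_groupoid \<Rightarrow> 'b top_groupoid \<Rightarrow> ('a \<times> 'b) top_groupoid" where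
  "prod_groupoid G H =
     \<lparr> gtop = prod_topology (gtop G) (gtop H),
       grange = map_prod (grange G) (grange H),
       gsource = map_prod (gsource G) (gsource H),
       gmult = (\<lambda>(g, h) (g', h'). (gmult G g g', gmult H h h')),
       ginv = map_prod (ginv G) (ginv H) \<rparr>"


lemma has_compact_open_basis_prod:
  assumes "has_compact_open_basis X" "has_compact_open_basis Y"
  shows "has_compact_open_basis (prod_topology X Y)"
proof -
  obtain \<B> where B: "\<And>B. B \<in> \<B> \<Longrightarrow> openin X B \<and> compactin X B"
      "\<And>U. openin X U \<Longrightarrow> \<exists>\<U>\<subseteq>\<B>. U = \<Union>\<U>"
    using assms(1) unfolding has_compact_open_basis_def by metis
  obtain \<C> where C: "\<And>B. B \<in> \<C> \<Longrightarrow> openin Y B \<and> compactin Y B"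
      "\<And>U. openin Y U \<Longrightarrow> \<exists>\<U>\<subseteq>\<C>. U = \<Union>\<U>"
    using assms(2) unfolding has_compact_open_basis_def by metis
  let ?D = "{B \<times> C | B C. B \<in> \<B> \<and> C \<in> \<C>}"
  have "\<exists>\<U>\<subseteq>?D. W = \<Union>\<U>" if W: "openin (prod_topology X Y) W" for W
  proof (intro exI conjI)
    show "{D \<in> ?D. D \<subseteq> W} \<subseteq> ?D" by (rule Collect_restrict)
    show "W = \<Union>{D \<in> ?D. D \<subseteq> W}"
    proof (intro subset_antisym subsetI)
      fix w assume "w \<in> W"
      obtain x y where w: "w = (x, y)" by (cases w)
      with \<open>w \<in> W\<close> W obtain U V where UV: "openin X U" "openin Y V" "x \<in> U" "y \<in> V" "U \<times> V \<subseteq> W"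
        unfolding openin_prod_topology_alt by meson
      obtain \<U> where U: "\<U> \<subseteq> \<B>" "U = \<Union>\<U>" using B(2)[OF UV(1)] by (elim exE conjE)
      obtain \<V> where V: "\<V> \<subseteq> \<C>" "V = \<Union>\<V>" using C(2)[OF UV(2)] by (elim exE conjE)
      from UV(3) U obtain B where B': "B \<in> \<B>" "x \<in> B" "B \<subseteq> U" by blast
      from UV(4) V obtain C where C': "C \<in> \<C>" "y \<in> C" "C \<subseteq> V" by blast
      have "B \<times> C \<in> {D \<in> ?D. D \<subseteq> W}" using B' C' UV(5) by blast
      moreover have "w \<in> B \<times> C" using w B' C' by simp
      ultimately show "w \<in> \<Union>{D \<in> ?D. D \<subseteq> W}" by (rule UnionI)
    qed blast
  qed
  moreover have "openin (prod_topology X Y) D \<and> compactin (prod_topology X Y) D" if "D \<in> ?D" for D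
    using that B(1) C(1) by (auto simp: openin_prod_Times_iff compactin_Times)
  ultimately have "(\<forall>D\<in>?D. openin (prod_topology X Y) D \<and> compactin (prod_topology X Y) D) \<and>
      (\<forall>W. openin (prod_topology X Y) W \<longrightarrow> (\<exists>\<U>\<subseteq>?D. W = \<Union>\<U>))"
    by (intro conjI[OF ballI allI[OF impI]])
  then show ?thesis
    unfolding has_compact_open_basis_def by (rule exI[of _ ?D])
qed

lemma local_homeomorphism_prod:
  assumes f: "local_homeomorphism X X' f" and g: "local_homeomorphism Y Y' g"
  shows "local_homeomorphism (prod_topology X Y) (prod_topology X' Y') (map_prod f g)"
  unfolding local_homeomorphism_def
proof
  fix w assume "w \<in> topspace (prod_topology X Y)"
  then obtain x y where w: "w = (x, y)" "x \<in> topspace X" "y \<in> topspace Y" by auto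
  obtain U where U: "openin X U" "x \<in> U" "openin X' (f ` U)"
      "homeomorphic_map (subtopology X U) (subtopology X' (f ` U)) f"
    using f w(2) unfolding local_homeomorphism_def by meson
  obtain V where V: "openin Y V" "y \<in> V" "openin Y' (g ` V)"
      "homeomorphic_map (subtopology Y V) (subtopology Y' (g ` V)) g"
    using g w(3) unfolding local_homeomorphism_def by meson
  obtain f' g' where "homeomorphic_maps (subtopology X U) (subtopology X' (f ` U)) f f'"
      "homeomorphic_maps (subtopology Y V) (subtopology Y' (g ` V)) g g'"
    using U(4) V(4) unfolding homeomorphic_map_maps by (elim exE)
  then have "homeomorphic_maps (subtopology (prod_topology X Y) (U \<times> V))
      (subtopology (prod_topology X' Y') (f ` U \<times> g ` V))
      (\<lambda>(x, y). (f x, g y)) (\<lambda>(x, y). (f' x, g' y))"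
    by (simp add: subtopology_Times homeomorphic_maps_prod)
  then have "homeomorphic_map (subtopology (prod_topology X Y) (U \<times> V))
      (subtopology (prod_topology X' Y') (f ` U \<times> g ` V)) (map_prod f g)"
    unfolding map_prod_def by (rule homeomorphic_maps_imp_map)
  moreover have "map_prod f g ` (U \<times> V) = f ` U \<times> g ` V" by auto
  ultimately show "\<exists>U. openin (prod_topology X Y) U \<and> w \<in> U \<and>
      openin (prod_topology X' Y') (map_prod f g ` U) \<and>
      homeomorphic_map (subtopology (prod_topology X Y) U)
        (subtopology (prod_topology X' Y') (map_prod f g ` U)) (map_prod f g)"
    using U V w by (intro exI[of _ "U \<times> V"]) (simp add: openin_prod_Times_iff)
qed

lemma arrows_prod_groupoid: "arrows (prod_groupoid G H) = arrows G \<times> arrows H"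
  by (simp add: arrows_def prod_groupoid_def)

lemma unit_space_prod_groupoid:
  "unit_space (prod_groupoid G H) = prod_topology (unit_space G) (unit_space H)"
proof -
  have "units (prod_groupoid G H) = units G \<times> units H"
    unfolding units_def arrows_prod_groupoid by (auto simp: prod_groupoid_def)
  then show ?thesis
    by (simp add: unit_space_def subtopology_Times prod_groupoid_def)
qed

lemma composable_prod_groupoid:
  "((g, h), (g', h')) \<in> composable (prod_groupoid G H) \<longleftrightarrow>
     (g, g') \<in> composable G \<and> (h, h') \<in> composable H"
  by (auto simp: composable_def arrows_prod_groupoid) (auto simp: prod_groupoid_def)

lemma groupoid_prod_groupoid:
  assumes "groupoid G" "groupoid H"
  shows "groupoid (prod_groupoid G H)"
proof -
  interpret G: groupoid G by fact
  interpret H: groupoid H by fact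
  have s: "grange (prod_groupoid G H) = map_prod (grange G) (grange H)"
    "gsource (prod_groupoid G H) = map_prod (gsource G) (gsource H)"
    "gmult (prod_groupoid G H) = (\<lambda>(g, h) (g', h'). (gmult G g g', gmult H h h'))"
    "ginv (prod_groupoid G H) = map_prod (ginv G) (ginv H)"
    by (simp_all add: prod_groupoid_def)
  show ?thesis
    by unfold_locales
      (auto simp: arrows_prod_groupoid composable_prod_groupoid s
        G.range_closed G.source_closed G.range_range G.source_range G.range_source G.source_source
        G.mult_closed G.range_mult G.source_mult G.mult_assoc G.range_mult_left G.source_mult_right
        G.inv_closed G.range_inv G.source_inv G.mult_inv_right G.mult_inv_left
        H.range_closed H.source_closed H.range_range H.source_range H.range_source H.source_source
        H.mult_closed H.range_mult H.source_mult H.mult_assoc H.range_mult_left H.source_mult_right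
        H.inv_closed H.range_inv H.source_inv H.mult_inv_right H.mult_inv_left)
qed

lemma ample_groupoid_prod_groupoid:
  assumes "ample_groupoid G" "ample_groupoid H"
  shows "ample_groupoid (prod_groupoid G H)"
proof -
  interpret G: ample_groupoid G by fact
  interpret H: ample_groupoid H by fact
  interpret P: groupoid "prod_groupoid G H"
    by (rule groupoid_prod_groupoid) unfold_locales
  let ?T = "prod_topology (gtop G) (gtop H)"
  let ?C = "subtopology (prod_topology ?T ?T) (composable (prod_groupoid G H))"
  have top: "gtop (prod_groupoid G H) = ?T" by (simp add: prod_groupoid_def)
  have pr: "continuous_map ?C ?T fst" "continuous_map ?C ?T snd"
    by (auto intro: continuous_map_from_subtopology continuous_map_fst continuous_map_snd)
  have "continuous_map ?C (gtop G) (\<lambda>x. fst (fst x))" "continuous_map ?C (gtop G) (\<lambda>x. fst (snd x))"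
    "continuous_map ?C (gtop H) (\<lambda>x. snd (fst x))" "continuous_map ?C (gtop H) (\<lambda>x. snd (snd x))"
    using continuous_map_compose[OF pr(1) continuous_map_fst] continuous_map_compose[OF pr(2) continuous_map_fst]
      continuous_map_compose[OF pr(1) continuous_map_snd] continuous_map_compose[OF pr(2) continuous_map_snd]
    by (simp_all add: comp_def)
  then have c: "continuous_map ?C (prod_topology (gtop G) (gtop G)) (\<lambda>x. (fst (fst x), fst (snd x)))"
    "continuous_map ?C (prod_topology (gtop H) (gtop H)) (\<lambda>x. (snd (fst x), snd (snd x)))"
    by (simp_all add: continuous_map_paired)
  have "continuous_map ?C (subtopology (prod_topology (gtop G) (gtop G)) (composable G))
      (\<lambda>x. (fst (fst x), fst (snd x)))"
    "continuous_map ?C (subtopology (prod_topology (gtop H) (gtop H)) (composable H))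
      (\<lambda>x. (snd (fst x), snd (snd x)))"
    using c by (auto intro!: continuous_map_into_subtopology simp: composable_prod_groupoid)
  then have m: "continuous_map ?C (gtop G) (\<lambda>x. gmult G (fst (fst x)) (fst (snd x)))"
    "continuous_map ?C (gtop H) (\<lambda>x. gmult H (snd (fst x)) (snd (snd x)))"
    using continuous_map_compose[OF _ G.continuous_mult] continuous_map_compose[OF _ H.continuous_mult]
    by (fastforce simp: comp_def)+
  show ?thesis
  proof
    show "has_compact_open_basis (gtop (prod_groupoid G H))"
      unfolding top
      by (rule has_compact_open_basis_prod[OF G.compact_open_basis H.compact_open_basis])
    show "continuous_map (gtop (prod_groupoid G H)) (gtop (prod_groupoid G H))
        (ginv (prod_groupoid G H))"
      using G.continuous_inv H.continuous_inv
      by (simp add: prod_groupoid_def map_prod_def continuous_map_prod_top)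
    show "continuous_map (subtopology (prod_topology (gtop (prod_groupoid G H))
        (gtop (prod_groupoid G H))) (composable (prod_groupoid G H))) (gtop (prod_groupoid G H))
        (\<lambda>(g, h). gmult (prod_groupoid G H) g h)"
      using m unfolding top by (simp add: prod_groupoid_def case_prod_unfold continuous_map_paired)
    show "Hausdorff_space (unit_space (prod_groupoid G H))"
      unfolding unit_space_prod_groupoid
      by (simp add: Hausdorff_space_prod_topology G.Hausdorff_unit_space H.Hausdorff_unit_space)
    show "local_homeomorphism (gtop (prod_groupoid G H)) (unit_space (prod_groupoid G H))
        (grange (prod_groupoid G H))"
      unfolding unit_space_prod_groupoid
      using local_homeomorphism_prod[OF G.local_homeomorphism_range H.local_homeomorphism_range]
      by (simp add: prod_groupoid_def)
    show "local_homeomorphism (gtop (prod_groupoid G H)) (unit_space (prod_groupoid G H))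
        (gsource (prod_groupoid G H))"
      unfolding unit_space_prod_groupoid
      using local_homeomorphism_prod[OF G.local_homeomorphism_source H.local_homeomorphism_source]
      by (simp add: prod_groupoid_def)
  qed
qed

lemma local_homeomorphism_discrete:
  assumes "f \<in> A \<rightarrow> B"
  shows "local_homeomorphism (discrete_topology A) (discrete_topology B) f"
  unfolding local_homeomorphism_def
proof
  fix x assume "x \<in> topspace (discrete_topology A)"
  then have x: "x \<in> A" "f x \<in> B" using assms by auto
  then have "A \<inter> {x} = {x}" "B \<inter> {f x} = {f x}" by auto
  then have "homeomorphic_map (subtopology (discrete_topology A) {x})
      (subtopology (discrete_topology B) (f ` {x})) f"
    by (auto simp: homeomorphic_map_def quotient_map_def)
  then show "\<exists>U. openin (discrete_topology A) U \<and> x \<in> U \<and> openin (discrete_topology B) (f ` U) \<and>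
      homeomorphic_map (subtopology (discrete_topology A) U) (subtopology (discrete_topology B) (f ` U)) f"
    using x by (intro exI[of _ "{x}"]) simp
qed

lemma ample_groupoid_full_relation: "ample_groupoid full_relation"
proof -
  have ar: "arrows full_relation = UNIV"
    by (simp add: arrows_def full_relation_def)
  have us: "unit_space full_relation = discrete_topology (units full_relation)"
    by (simp add: unit_space_def full_relation_def)
  have top: "gtop full_relation = discrete_topology UNIV"
    by (simp add: full_relation_def)
  have sel: "grange full_relation = (\<lambda>(i, j). (i, i))" "gsource full_relation = (\<lambda>(i, j). (j, j))"
    "gmult full_relation = (\<lambda>(i, j) (k, l). (i, l))" "ginv full_relation = (\<lambda>(i, j). (j, i))"
    by (simp_all add: full_relation_def)
  interpret groupoid full_relation
    by unfold_locales (auto simp: ar composable_def sel)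
  show ?thesis
  proof
    have "\<exists>\<U>\<subseteq>range (\<lambda>x. {x}). U = \<Union>\<U>" for U :: "(nat \<times> nat) set"
      by (rule exI[of _ "(\<lambda>x. {x}) ` U"]) auto
    then show "has_compact_open_basis (gtop full_relation)"
      unfolding has_compact_open_basis_def top
      by (intro exI[of _ "range (\<lambda>x. {x})"]) auto
    show "local_homeomorphism (gtop full_relation) (unit_space full_relation) (grange full_relation)"
      unfolding top us by (rule local_homeomorphism_discrete) (auto simp: units_def ar)
    show "local_homeomorphism (gtop full_relation) (unit_space full_relation) (gsource full_relation)"
      unfolding top us
      by (rule local_homeomorphism_discrete) (auto simp: units_def ar sel image_iff)
  qed (simp_all add: us top prod_topology_discrete_topology[symmetric] Hausdorff_space_discrete_topology)
qed


section \<open>Actions\<close>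

definition left_dom :: "'a top_groupoid \<Rightarrow> 'z topology \<Rightarrow> ('z \<Rightarrow> 'a) \<Rightarrow> ('a \<times> 'z) set" where
  "left_dom G Z p = {(g, z). g \<in> arrows G \<and> z \<in> topspace Z \<and> gsource G g = p z}"

definition left_dom_topology ::
    "'a top_groupoid \<Rightarrow> 'z topology \<Rightarrow> ('z \<Rightarrow> 'a) \<Rightarrow> ('a \<times> 'z) topology" where
  "left_dom_topology G Z p = subtopology (prod_topology (gtop G) Z) (left_dom G Z p)"

definition left_action ::
    "'a top_groupoid \<Rightarrow> 'z topology \<Rightarrow> ('z \<Rightarrow> 'a) \<Rightarrow> ('a \<Rightarrow> 'z \<Rightarrow> 'z) \<Rightarrow> bool" where
  "left_action G Z p act \<longleftrightarrow>
     continuous_map Z (unit_space G) p \<and>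
     continuous_map (left_dom_topology G Z p) Z (\<lambda>(g, z). act g z) \<and>
     (\<forall>(g, z) \<in> left_dom G Z p. p (act g z) = grange G g) \<and>
     (\<forall>(g, h) \<in> composable G. \<forall>z. (h, z) \<in> left_dom G Z p \<longrightarrow>
        act (gmult G g h) z = act g (act h z)) \<and>
     (\<forall>z \<in> topspace Z. act (p z) z = z)"

definition free_left_action ::
    "'a top_groupoid \<Rightarrow> 'z topology \<Rightarrow> ('z \<Rightarrow> 'a) \<Rightarrow> ('a \<Rightarrow> 'z \<Rightarrow> 'z) \<Rightarrow> bool" where
  "free_left_action G Z p act \<longleftrightarrow>
     (\<forall>(g, z) \<in> left_dom G Z p. act g z = z \<longrightarrow> g \<in> units G)"

definition proper_left_action ::
    "'a top_groupoid \<Rightarrow> 'z topology \<Rightarrow> ('z \<Rightarrow> 'a) \<Rightarrow> ('a \<Rightarrow> 'z \<Rightarrow> 'z) \<Rightarrow> bool" where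
  "proper_left_action G Z p act \<longleftrightarrow>
     proper_map (left_dom_topology G Z p) (prod_topology Z Z) (\<lambda>(g, z). (act g z, z))"

definition left_orbit ::
    "'a top_groupoid \<Rightarrow> 'z topology \<Rightarrow> ('z \<Rightarrow> 'a) \<Rightarrow> ('a \<Rightarrow> 'z \<Rightarrow> 'z) \<Rightarrow> 'z \<Rightarrow> 'z set" where
  "left_orbit G Z p act z = {act g z | g. (g, z) \<in> left_dom G Z p}"

definition right_dom :: "'b top_groupoid \<Rightarrow> 'z topology \<Rightarrow> ('z \<Rightarrow> 'b) \<Rightarrow> ('z \<times> 'b) set" where
  "right_dom H Z q = {(z, h). z \<in> topspace Z \<and> h \<in> arrows H \<and> q z = grange H h}"

definition right_dom_topology ::
    "'b top_groupoid \<Rightarrow> 'z topology \<Rightarrow> ('z \<Rightarrow> 'b) \<Rightarrow> ('z \<times> 'b) topology" where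
  "right_dom_topology H Z q = subtopology (prod_topology Z (gtop H)) (right_dom H Z q)"

definition right_action ::
    "'b top_groupoid \<Rightarrow> 'z topology \<Rightarrow> ('z \<Rightarrow> 'b) \<Rightarrow> ('z \<Rightarrow> 'b \<Rightarrow> 'z) \<Rightarrow> bool" where
  "right_action H Z q act \<longleftrightarrow>
     continuous_map Z (unit_space H) q \<and>
     continuous_map (right_dom_topology H Z q) Z (\<lambda>(z, h). act z h) \<and>
     (\<forall>(z, h) \<in> right_dom H Z q. q (act z h) = gsource H h) \<and>
     (\<forall>(h, k) \<in> composable H. \<forall>z. (z, h) \<in> right_dom H Z q \<longrightarrow>
        act z (gmult H h k) = act (act z h) k) \<and>
     (\<forall>z \<in> topspace Z. act z (q z) = z)"

definition free_right_action ::
    "'b top_groupoid \<Rightarrow> 'z topology \<Rightarrow> ('z \<Rightarrow> 'b) \<Rightarrow> ('z \<Rightarrow> 'b \<Rightarrow> 'z) \<Rightarrow> bool" where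
  "free_right_action H Z q act \<longleftrightarrow>
     (\<forall>(z, h) \<in> right_dom H Z q. act z h = z \<longrightarrow> h \<in> units H)"

definition proper_right_action ::
    "'b top_groupoid \<Rightarrow> 'z topology \<Rightarrow> ('z \<Rightarrow> 'b) \<Rightarrow> ('z \<Rightarrow> 'b \<Rightarrow> 'z) \<Rightarrow> bool" where
  "proper_right_action H Z q act \<longleftrightarrow>
     proper_map (right_dom_topology H Z q) (prod_topology Z Z) (\<lambda>(z, h). (act z h, z))"

definition right_orbit ::
    "'b top_groupoid \<Rightarrow> 'z topology \<Rightarrow> ('z \<Rightarrow> 'b) \<Rightarrow> ('z \<Rightarrow> 'b \<Rightarrow> 'z) \<Rightarrow> 'z \<Rightarrow> 'z set" where
  "right_orbit H Z q act z = {act z h | h. (z, h) \<in> right_dom H Z q}"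


section \<open>Groupoid equivalence\<close>

definition groupoid_equivalence ::
    "'a top_groupoid \<Rightarrow> 'b top_groupoid \<Rightarrow> 'z topology \<Rightarrow> ('z \<Rightarrow> 'a) \<Rightarrow> ('z \<Rightarrow> 'b) \<Rightarrow>
     ('a \<Rightarrow> 'z \<Rightarrow> 'z) \<Rightarrow> ('z \<Rightarrow> 'b \<Rightarrow> 'z) \<Rightarrow> bool" where
  "groupoid_equivalence G H Z p q lact ract \<longleftrightarrow>
     left_action G Z p lact \<and> free_left_action G Z p lact \<and> proper_left_action G Z p lact \<and>
     right_action H Z q ract \<and> free_right_action H Z q ract \<and> proper_right_action H Z q ract \<and>
     (\<forall>(g, z) \<in> left_dom G Z p. q (lact g z) = q z) \<and>
     (\<forall>(z, h) \<in> right_dom H Z q. p (ract z h) = p z) \<and>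
     (\<forall>g z h. (g, z) \<in> left_dom G Z p \<and> (z, h) \<in> right_dom H Z q \<longrightarrow>
        ract (lact g z) h = lact g (ract z h)) \<and>
     induces_homeomorphism Z (right_orbit H Z q ract) (unit_space G) p \<and>
     induces_homeomorphism Z (left_orbit G Z p lact) (unit_space H) q"

text \<open>HOL cannot quantify over the type carrying \<open>Z\<close>. Taking it to be \<open>'a \<times> 'b\<close> loses nothing:
  choosing a point in each fibre of \<open>p\<close> embeds any equivalence into \<open>units G \<times> arrows H\<close>; see
  \<open>groupoid_equivalentI\<close> below.\<close>

definition groupoid_equivalent :: "'a top_groupoid \<Rightarrow> 'b top_groupoid \<Rightarrow> bool" where
  "groupoid_equivalent G H \<longleftrightarrow>
     (\<exists>(Z :: ('a \<times> 'b) topology) p q lact ract. groupoid_equivalence G H Z p q lact ract)"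

lemma left_action_closed:
  assumes "left_action G Z p act" "(g, z) \<in> left_dom G Z p"
  shows "act g z \<in> topspace Z"
proof -
  have c: "continuous_map (left_dom_topology G Z p) Z (\<lambda>(g, z). act g z)"
    using assms(1) by (simp add: left_action_def)
  have "(g, z) \<in> topspace (left_dom_topology G Z p)"
    using assms(2) by (auto simp: left_dom_topology_def left_dom_def arrows_def)
  then show ?thesis
    using continuous_map_image_subset_topspace[OF c] by auto
qed

lemma right_action_closed:
  assumes "right_action H Z q act" "(z, h) \<in> right_dom H Z q"
  shows "act z h \<in> topspace Z"
proof -
  have c: "continuous_map (right_dom_topology H Z q) Z (\<lambda>(z, h). act z h)"
    using assms(1) by (simp add: right_action_def)
  have "(z, h) \<in> topspace (right_dom_topology H Z q)"
    using assms(2) by (auto simp: right_dom_topology_def right_dom_def arrows_def)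
  then show ?thesis
    using continuous_map_image_subset_topspace[OF c] by auto
qed

lemma proper_map_cong:
  assumes "proper_map X Y f" and eq: "\<And>x. x \<in> topspace X \<Longrightarrow> f x = g x"
  shows "proper_map X Y g"
proof -
  have "g ` C = f ` C" if "closedin X C" for C
    using closedin_subset[OF that] eq by (intro image_cong) auto
  moreover have "{x \<in> topspace X. g x = y} = {x \<in> topspace X. f x = y}" for y
    using eq by auto
  ultimately show ?thesis
    using assms(1) by (simp add: proper_map_def closed_map_def)
qed

lemma groupoid_equivalence_transfer:
  assumes E: "groupoid_equivalence G H Z p q l r"
    and ed: "homeomorphic_maps Z W e d"
  shows "groupoid_equivalence G H W (p \<circ> d) (q \<circ> d) (\<lambda>g w. e (l g (d w))) (\<lambda>w h. e (r (d w) h))"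
proof -
  have ce: "continuous_map Z W e" and cd: "continuous_map W Z d"
    using ed by (auto simp: homeomorphic_maps_def)
  have de [simp]: "d (e z) = z" "e z \<in> topspace W" if "z \<in> topspace Z" for z
    using ed ce that by (auto simp: homeomorphic_maps_def continuous_map_def)
  have ed' [simp]: "e (d w) = w" "d w \<in> topspace Z" if "w \<in> topspace W" for w
    using ed cd that by (auto simp: homeomorphic_maps_def continuous_map_def)
  have hd: "homeomorphic_map W Z d" and he: "homeomorphic_map Z W e"
    using ed homeomorphic_maps_map homeomorphic_maps_sym by blast+
  have L: "left_action G Z p l" and R: "right_action H Z q r"
    using E by (auto simp: groupoid_equivalence_def)
  have cl [simp]: "l g z \<in> topspace Z" if "(g, z) \<in> left_dom G Z p" for g z
    using left_action_closed[OF L that] .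
  have cr [simp]: "r z h \<in> topspace Z" if "(z, h) \<in> right_dom H Z q" for z h
    using right_action_closed[OF R that] .
  have ld: "(g, w) \<in> left_dom G W (p \<circ> d) \<longleftrightarrow> w \<in> topspace W \<and> (g, d w) \<in> left_dom G Z p" for g w
    by (auto simp: left_dom_def)
  have rd: "(w, h) \<in> right_dom H W (q \<circ> d) \<longleftrightarrow> w \<in> topspace W \<and> (d w, h) \<in> right_dom H Z q" for h w
    by (auto simp: right_dom_def)
  let ?D = "\<lambda>(g, w). (g, d w)" and ?D' = "\<lambda>(w, h). (d w, h)"
  have hL: "homeomorphic_map (left_dom_topology G W (p \<circ> d)) (left_dom_topology G Z p) ?D"
    unfolding left_dom_topology_def
  proof (rule homeomorphic_map_subtopologies_alt)
    have "homeomorphic_maps (prod_topology (gtop G) W) (prod_topology (gtop G) Z)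
        (\<lambda>(x, y). (id x, d y)) (\<lambda>(x, y). (id x, e y))"
      using ed homeomorphic_maps_sym homeomorphic_maps_id homeomorphic_maps_prod by blast
    then show "homeomorphic_map (prod_topology (gtop G) W) (prod_topology (gtop G) Z) ?D"
      unfolding id_apply homeomorphic_map_maps by blast
    fix x assume "x \<in> topspace (prod_topology (gtop G) W)"
      and "?D x \<in> topspace (prod_topology (gtop G) Z)"
    then show "?D x \<in> left_dom G Z p \<longleftrightarrow> x \<in> left_dom G W (p \<circ> d)"
      by (cases x) (simp add: ld)
  qed
  have hR: "homeomorphic_map (right_dom_topology H W (q \<circ> d)) (right_dom_topology H Z q) ?D'"
    unfolding right_dom_topology_def
  proof (rule homeomorphic_map_subtopologies_alt)
    have "homeomorphic_maps (prod_topology W (gtop H)) (prod_topology Z (gtop H))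
        (\<lambda>(x, y). (d x, id y)) (\<lambda>(x, y). (e x, id y))"
      using ed homeomorphic_maps_sym homeomorphic_maps_id homeomorphic_maps_prod by blast
    then show "homeomorphic_map (prod_topology W (gtop H)) (prod_topology Z (gtop H)) ?D'"
      unfolding id_apply homeomorphic_map_maps by blast
    fix x assume "x \<in> topspace (prod_topology W (gtop H))"
      and "?D' x \<in> topspace (prod_topology Z (gtop H))"
    then show "?D' x \<in> right_dom H Z q \<longleftrightarrow> x \<in> right_dom H W (q \<circ> d)"
      by (cases x) (simp add: rd)
  qed
  have tL: "x \<in> topspace (left_dom_topology G W (p \<circ> d)) \<Longrightarrow> x \<in> left_dom G W (p \<circ> d)" for x
    by (simp add: left_dom_topology_def)
  have tR: "x \<in> topspace (right_dom_topology H W (q \<circ> d)) \<Longrightarrow> x \<in> right_dom H W (q \<circ> d)" for x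
    by (simp add: right_dom_topology_def)
  let ?EE = "\<lambda>(x, y). (e x, e y)"
  have hEE: "proper_map (prod_topology Z Z) (prod_topology W W) ?EE"
  proof -
    have "homeomorphic_maps (prod_topology Z Z) (prod_topology W W) ?EE (\<lambda>(x, y). (d x, d y))"
      using ed by (simp add: homeomorphic_maps_prod)
    then show ?thesis
      by (rule homeomorphic_imp_proper_map[OF homeomorphic_maps_imp_map])
  qed

  have "left_action G W (p \<circ> d) (\<lambda>g w. e (l g (d w)))"
    unfolding left_action_def
  proof (intro conjI)
    show "continuous_map W (unit_space G) (p \<circ> d)"
      using L cd by (auto simp: left_action_def intro: continuous_map_compose)
    have "continuous_map (left_dom_topology G W (p \<circ> d)) W (e \<circ> (\<lambda>(g, z). l g z) \<circ> ?D)"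
      using L ce homeomorphic_imp_continuous_map[OF hL]
      by (auto simp: left_action_def intro!: continuous_map_compose)
    then show "continuous_map (left_dom_topology G W (p \<circ> d)) W (\<lambda>(g, z). e (l g (d z)))"
      by (simp add: comp_def case_prod_unfold)
    show "\<forall>(g, h)\<in>composable G. \<forall>z. (h, z) \<in> left_dom G W (p \<circ> d) \<longrightarrow>
        e (l (gmult G g h) (d z)) = e (l g (d (e (l h (d z)))))"
    proof clarify
      fix g h z assume gh: "(g, h) \<in> composable G" and "(h, z) \<in> left_dom G W (p \<circ> d)"
      then have hz: "(h, d z) \<in> left_dom G Z p" by (simp add: ld)
      have "l (gmult G g h) (d z) = l g (l h (d z))"
        using L gh hz unfolding left_action_def by blast
      then show "e (l (gmult G g h) (d z)) = e (l g (d (e (l h (d z)))))"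
        using hz by simp
    qed
  qed (use L in \<open>auto simp: left_action_def ld\<close>)
  moreover have "right_action H W (q \<circ> d) (\<lambda>w h. e (r (d w) h))"
    unfolding right_action_def
  proof (intro conjI)
    show "continuous_map W (unit_space H) (q \<circ> d)"
      using R cd by (auto simp: right_action_def intro: continuous_map_compose)
    have "continuous_map (right_dom_topology H W (q \<circ> d)) W (e \<circ> (\<lambda>(z, h). r z h) \<circ> ?D')"
      using R ce homeomorphic_imp_continuous_map[OF hR]
      by (auto simp: right_action_def intro!: continuous_map_compose)
    then show "continuous_map (right_dom_topology H W (q \<circ> d)) W (\<lambda>(z, h). e (r (d z) h))"
      by (simp add: comp_def case_prod_unfold)
    show "\<forall>(h, k)\<in>composable H. \<forall>z. (z, h) \<in> right_dom H W (q \<circ> d) \<longrightarrow>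
        e (r (d z) (gmult H h k)) = e (r (d (e (r (d z) h))) k)"
    proof clarify
      fix h k z assume hk: "(h, k) \<in> composable H" and "(z, h) \<in> right_dom H W (q \<circ> d)"
      then have zh: "(d z, h) \<in> right_dom H Z q" by (simp add: rd)
      have "r (d z) (gmult H h k) = r (r (d z) h) k"
        using R hk zh unfolding right_action_def by blast
      then show "e (r (d z) (gmult H h k)) = e (r (d (e (r (d z) h))) k)"
        using zh by simp
    qed
  qed (use R in \<open>auto simp: right_action_def rd\<close>)
  moreover have "free_left_action G W (p \<circ> d) (\<lambda>g w. e (l g (d w)))"
    unfolding free_left_action_def
  proof (clarify, unfold ld)
    fix g w assume gw: "w \<in> topspace W \<and> (g, d w) \<in> left_dom G Z p" and "e (l g (d w)) = w"
    then have "l g (d w) = d w" by (metis cl de(1))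
    then show "g \<in> units G"
      using E gw by (auto simp: groupoid_equivalence_def free_left_action_def)
  qed
  moreover have "free_right_action H W (q \<circ> d) (\<lambda>w h. e (r (d w) h))"
    unfolding free_right_action_def
  proof (clarify, unfold rd)
    fix w h assume gw: "w \<in> topspace W \<and> (d w, h) \<in> right_dom H Z q" and "e (r (d w) h) = w"
    then have "r (d w) h = d w" by (metis cr de(1))
    then show "h \<in> units H"
      using E gw by (auto simp: groupoid_equivalence_def free_right_action_def)
  qed
  moreover have "proper_left_action G W (p \<circ> d) (\<lambda>g w. e (l g (d w)))"
    unfolding proper_left_action_def
  proof (rule proper_map_cong)
    have P: "proper_map (left_dom_topology G Z p) (prod_topology Z Z) (\<lambda>(g, z). (l g z, z))"
      using E by (simp add: groupoid_equivalence_def proper_left_action_def)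
    show "proper_map (left_dom_topology G W (p \<circ> d)) (prod_topology W W)
        (?EE \<circ> ((\<lambda>(g, z). (l g z, z)) \<circ> ?D))"
      by (rule proper_map_compose[OF proper_map_compose[OF homeomorphic_imp_proper_map[OF hL] P] hEE])
  qed (use tL in \<open>auto simp: ld\<close>)
  moreover have "proper_right_action H W (q \<circ> d) (\<lambda>w h. e (r (d w) h))"
    unfolding proper_right_action_def
  proof (rule proper_map_cong)
    have P: "proper_map (right_dom_topology H Z q) (prod_topology Z Z) (\<lambda>(z, h). (r z h, z))"
      using E by (simp add: groupoid_equivalence_def proper_right_action_def)
    show "proper_map (right_dom_topology H W (q \<circ> d)) (prod_topology W W)
        (?EE \<circ> ((\<lambda>(z, h). (r z h, z)) \<circ> ?D'))"
      by (rule proper_map_compose[OF proper_map_compose[OF homeomorphic_imp_proper_map[OF hR] P] hEE])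
  qed (use tR in \<open>auto simp: rd\<close>)
  moreover have "\<forall>(g, w) \<in> left_dom G W (p \<circ> d). (q \<circ> d) (e (l g (d w))) = (q \<circ> d) w"
    "\<forall>(w, h) \<in> right_dom H W (q \<circ> d). (p \<circ> d) (e (r (d w) h)) = (p \<circ> d) w"
    using E by (auto simp: groupoid_equivalence_def ld rd)
  moreover have "\<forall>g w h. (g, w) \<in> left_dom G W (p \<circ> d) \<and> (w, h) \<in> right_dom H W (q \<circ> d) \<longrightarrow>
        e (r (d (e (l g (d w)))) h) = e (l g (d (e (r (d w) h))))"
    using E by (auto simp: groupoid_equivalence_def ld rd)
  moreover have "induces_homeomorphism W (right_orbit H W (q \<circ> d) (\<lambda>w h. e (r (d w) h)))
      (unit_space G) (p \<circ> d)"
  proof -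
    have o: "right_orbit H W (q \<circ> d) (\<lambda>w h. e (r (d w) h)) w = e ` right_orbit H Z q r (d w)"
      if "w \<in> topspace W" for w
      using that by (auto simp: right_orbit_def rd)
    have sub: "right_orbit H Z q r z \<subseteq> topspace Z" for z
      by (auto simp: right_orbit_def)
    have "inj_on e (topspace Z)" by (metis de(1) inj_onI)
    then have "e ` right_orbit H Z q r z = e ` right_orbit H Z q r z' \<longleftrightarrow>
        right_orbit H Z q r z = right_orbit H Z q r z'" for z z'
      using sub inj_on_image_eq_iff by metis
    moreover have "induces_homeomorphism Z (right_orbit H Z q r) (unit_space G) p"
      using E by (simp add: groupoid_equivalence_def)
    moreover have "quotient_map W Z d"
      using hd homeomorphic_map_def by blast
    ultimately show ?thesis
      unfolding induces_homeomorphism_iff by (simp add: o quotient_map_compose)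
  qed
  moreover have "induces_homeomorphism W (left_orbit G W (p \<circ> d) (\<lambda>g w. e (l g (d w))))
      (unit_space H) (q \<circ> d)"
  proof -
    have o: "left_orbit G W (p \<circ> d) (\<lambda>g w. e (l g (d w))) w = e ` left_orbit G Z p l (d w)"
      if "w \<in> topspace W" for w
      using that by (auto simp: left_orbit_def ld)
    have sub: "left_orbit G Z p l z \<subseteq> topspace Z" for z
      by (auto simp: left_orbit_def)
    have "inj_on e (topspace Z)" by (metis de(1) inj_onI)
    then have "e ` left_orbit G Z p l z = e ` left_orbit G Z p l z' \<longleftrightarrow>
        left_orbit G Z p l z = left_orbit G Z p l z'" for z z'
      using sub inj_on_image_eq_iff by metis
    moreover have "induces_homeomorphism Z (left_orbit G Z p l) (unit_space H) q"
      using E by (simp add: groupoid_equivalence_def)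
    moreover have "quotient_map W Z d"
      using hd homeomorphic_map_def by blast
    ultimately show ?thesis
      unfolding induces_homeomorphism_iff by (simp add: o quotient_map_compose)
  qed
  ultimately show ?thesis
    unfolding groupoid_equivalence_def by (intro conjI)
qed

lemma homeomorphic_maps_image_exists:
  assumes "inj_on e (topspace Z)"
  shows "\<exists>W. homeomorphic_maps Z W e (inv_into (topspace Z) e)"
proof -
  have "homeomorphic_map Z (quotient_topology Z e) e"
    by (simp add: homeomorphic_map_def quotient_map_quotient_topology assms)
  then obtain d where d: "homeomorphic_maps Z (quotient_topology Z e) e d"
    using homeomorphic_map_maps by blast
  have "d y = inv_into (topspace Z) e y" if "y \<in> topspace (quotient_topology Z e)" for y
    using that d assms by (auto simp: homeomorphic_maps_def inv_into_f_f)
  then have "homeomorphic_maps Z (quotient_topology Z e) e (inv_into (topspace Z) e)"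
    using d homeomorphic_maps_eq by metis
  then show ?thesis by blast
qed

theorem groupoid_equivalentI:
  fixes G :: "'a top_groupoid" and H :: "'b top_groupoid" and Z :: "'z topology"
  assumes "groupoid H" and E: "groupoid_equivalence G H Z p q l r"
  shows "groupoid_equivalent G H"
proof -
  have R: "right_action H Z q r" and I: "induces_homeomorphism Z (right_orbit H Z q r) (unit_space G) p"
    using E by (auto simp: groupoid_equivalence_def)
  define b where "b x = (SOME z. z \<in> topspace Z \<and> p z = x)" for x
  have b: "b (p z) \<in> topspace Z" "p (b (p z)) = p z" if "z \<in> topspace Z" for z
    unfolding b_def using someI[of "\<lambda>y. y \<in> topspace Z \<and> p y = p z" z] that by auto
  have "\<exists>h. r (b (p z)) h = z" if z: "z \<in> topspace Z" for z
  proof -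
    have "continuous_map Z (unit_space H) q" and unit: "r z (q z) = z"
      using R z by (auto simp: right_action_def)
    then have "q z \<in> arrows H" "q z \<in> units H"
      using z continuous_map_image_subset_topspace by (fastforce simp: unit_space_def arrows_def)+
    then have "(z, q z) \<in> right_dom H Z q"
      using \<open>groupoid H\<close> z by (auto simp: right_dom_def units_def groupoid.range_range)
    then have "z \<in> right_orbit H Z q r z"
      unfolding right_orbit_def using unit by force
    moreover have "right_orbit H Z q r (b (p z)) = right_orbit H Z q r z"
      using I b z by (simp add: induces_homeomorphism_iff)
    ultimately have "z \<in> right_orbit H Z q r (b (p z))" by simp
    then show ?thesis unfolding right_orbit_def mem_Collect_eq by metis
  qed
  then obtain k where k: "\<And>z. z \<in> topspace Z \<Longrightarrow> r (b (p z)) (k z) = z" by metis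
  have "inj_on (\<lambda>z. (p z, k z)) (topspace Z)"
    by (rule inj_onI) (metis k prod.inject)
  then obtain W :: "('a \<times> 'b) topology"
    where "homeomorphic_maps Z W (\<lambda>z. (p z, k z)) (inv_into (topspace Z) (\<lambda>z. (p z, k z)))"
    using homeomorphic_maps_image_exists by blast
  from groupoid_equivalence_transfer[OF E this] show ?thesis
    unfolding groupoid_equivalent_def by blast
qed

end

(* An equivalence Z makes both anchor maps p : Z -> G^0 and q : Z -> H^0 surjective local
   homeomorphisms, since an orbit map of a free and proper action of an ample groupoid is one.
   Covering Z by countably many compact open sets on which p and q are injective yields embeddings
   of G^0 x N into H^0 x N and vice versa that are implemented by open subsets of Z x N x N. A
   Cantor-Schroeder-Bernstein argument merges them into one open subset W of Z x N x N that projects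
   homeomorphically onto G^0 x N and onto H^0 x N. Then (g, i, j) is sent to (h, i', j'), where
   (v, i, i') and (w, j, j') are the points of W over (r(g), i) and (s(g), j) and v h = g w.
   Conversely, an isomorphism embeds both G and H as full corners in K = H x R, and the arrows of K
   with range in the first corner and source in the second form an equivalence.
   Statements about one side of Z are transferred to the other by passing to opposite groupoids. *)

theory Submission
  imports Defs
begin

section \<open>Opposite groupoids\<close>

text \<open>The obstacle is separation. \<open>Z\<close> can be as non-Hausdorff as
  \<open>G\<close>: with \<open>Z = G\<close> it is the arrow space itself. A compact open subset of
  \<open>Z\<close> need not be closed, so complements are never taken in \<open>Z\<close>. They are
  taken in the unit spaces, where Hausdorffness makes the image of a compact open set clopen. The
  same concern rules out the plain Cantor-Schroeder-Bernstein decomposition: it iterates infinitely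
  often and yields an infinite union of clopen sets, which need not be closed. The factor \<nat>
  gives room to avoid this. Each embedding sends the part of its n-th piece at level i to the level
  one above the code of (n, i). Pieces with overlapping images are thereby separated, level 0 is
  missed, and the decomposition of a level is settled after finitely many steps. Sigma-compactness
  makes countably many pieces enough. An arrow of the stabilization carries two levels, one for its
  range and one for its source, and each of them is moved by the matching point over that end. For
  the converse, the stabilization of \<open>H\<close> is one groupoid containing both
  \<open>G\<close> and \<open>H\<close>, so that its associativity makes the two actions
  commute.\<close>

context groupoid
begin

lemma units_iff: "x \<in> units G \<longleftrightarrow> x \<in> arrows G \<and> grange G x = x"
  unfolding units_def using range_closed range_range by (metis image_iff)

lemma units_iff_source: "x \<in> units G \<longleftrightarrow> x \<in> arrows G \<and> gsource G x = x"
  unfolding units_iff using source_range range_source by metis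

lemma range_unit: "x \<in> arrows G \<Longrightarrow> grange G x \<in> units G"
  by (simp add: units_def)

lemma source_unit: "x \<in> arrows G \<Longrightarrow> gsource G x \<in> units G"
  by (simp add: units_iff source_closed range_source)

text \<open>A unit whose source is \<open>grange G k\<close> equals \<open>grange G k\<close>, so
  multiplying \<open>h k^-1\<close> by \<open>k\<close> returns both \<open>h\<close> and
  \<open>k\<close>. This turns freeness of an action into cancellation.\<close>

lemma eq_if_mult_inv_unit:
  assumes "h \<in> arrows G" "k \<in> arrows G" "gsource G h = gsource G k"
    and "gmult G h (ginv G k) \<in> units G"
  shows "h = k"
proof -
  have c: "(h, ginv G k) \<in> composable G" "(ginv G k, k) \<in> composable G"
    using assms by (auto simp: composable_def inv_closed range_inv source_inv)
  have u: "gmult G h (ginv G k) = grange G k"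
    using assms(4) source_mult[OF c(1)] source_inv[OF assms(2)] units_iff_source by metis
  have "h = gmult G h (gmult G (ginv G k) k)"
    using assms by (simp add: mult_inv_left source_mult_right flip: assms(3))
  also have "\<dots> = gmult G (gmult G h (ginv G k)) k" by (simp add: mult_assoc c)
  also have "\<dots> = k" by (simp add: u range_mult_left assms)
  finally show ?thesis .
qed

end

section \<open>Local homeomorphisms and the topology of the unit space\<close>

lemma local_homeomorphism_imp_open_map:
  assumes "local_homeomorphism X Y f"
  shows "open_map X Y f"
  unfolding open_map_def
proof (intro allI impI)
  fix V assume V: "openin X V"
  show "openin Y (f ` V)"
  proof (subst openin_subopen, clarify)
    fix x assume x: "x \<in> V"
    then obtain U where U: "openin X U" "x \<in> U" "openin Y (f ` U)"
        "homeomorphic_map (subtopology X U) (subtopology Y (f ` U)) f"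
      using assms openin_subset[OF V] unfolding local_homeomorphism_def by blast
    have "openin (subtopology X U) (U \<inter> V)"
      using V by (auto simp: openin_subtopology)
    then have "openin (subtopology Y (f ` U)) (f ` (U \<inter> V))"
      using homeomorphic_imp_open_map[OF U(4)] by (simp add: open_map_def)
    then have "openin Y (f ` (U \<inter> V))"
      using U(3) openin_trans_full by blast
    then show "\<exists>T. openin Y T \<and> f x \<in> T \<and> T \<subseteq> f ` V"
      using U(2) x by (intro exI[of _ "f ` (U \<inter> V)"]) auto
  qed
qed

lemma local_homeomorphism_imp_continuous_map:
  assumes "local_homeomorphism X Y f"
  shows "continuous_map X Y f"
  unfolding continuous_map_openin_preimage_eq
proof (intro conjI allI impI funcsetI)
  fix x assume "x \<in> topspace X"
  then obtain U where "x \<in> U" "openin Y (f ` U)"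
    using assms unfolding local_homeomorphism_def by blast
  then show "f x \<in> topspace Y" using openin_subset by blast
next
  fix V assume V: "openin Y V"
  show "openin X (topspace X \<inter> f -` V)"
  proof (subst openin_subopen, clarify)
    fix x assume x: "x \<in> topspace X" "f x \<in> V"
    then obtain U where U: "openin X U" "x \<in> U" "openin Y (f ` U)"
        "homeomorphic_map (subtopology X U) (subtopology Y (f ` U)) f"
      using assms unfolding local_homeomorphism_def by blast
    have "continuous_map (subtopology X U) Y f"
      using homeomorphic_imp_continuous_map[OF U(4)] by (simp add: continuous_map_in_subtopology)
    from openin_continuous_map_preimage[OF this V]
    have "openin X {x \<in> topspace (subtopology X U). f x \<in> V}"
      using U(1) openin_trans_full by blast
    then show "\<exists>T. openin X T \<and> x \<in> T \<and> T \<subseteq> topspace X \<inter> f -` V"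
      using U(2) x by (intro exI[of _ "{x \<in> topspace (subtopology X U). f x \<in> V}"]) auto
  qed
qed

context ample_groupoid
begin

lemma continuous_range: "continuous_map (gtop G) (unit_space G) (grange G)"
  by (rule local_homeomorphism_imp_continuous_map[OF local_homeomorphism_range])

lemma continuous_source: "continuous_map (gtop G) (unit_space G) (gsource G)"
  by (rule local_homeomorphism_imp_continuous_map[OF local_homeomorphism_source])

lemma units_subset: "units G \<subseteq> topspace (gtop G)"
  using units_iff by (auto simp: arrows_def)

lemma topspace_unit_space: "topspace (unit_space G) = units G"
  using units_subset by (auto simp: unit_space_def)

text \<open>Near a unit the range map is injective on some open \<open>U\<close>. If
  \<open>g\<close> and \<open>grange G g\<close> both lie in \<open>U\<close>, they have the same
  range and hence coincide, so every arrow of \<open>U\<close> whose range is again in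
  \<open>U\<close> is a unit.\<close>

lemma openin_units: "openin (gtop G) (units G)"
proof (subst openin_subopen, clarify)
  fix x assume x: "x \<in> units G"
  then have xx: "x \<in> arrows G" "grange G x = x" by (auto simp: units_iff)
  then obtain U where U: "openin (gtop G) U" "x \<in> U"
      "homeomorphic_map (subtopology (gtop G) U) (subtopology (unit_space G) (grange G ` U)) (grange G)"
    using local_homeomorphism_range unfolding local_homeomorphism_def arrows_def by blast
  have inj: "inj_on (grange G) U"
    using homeomorphic_imp_injective_map[OF U(3)] openin_subset[OF U(1)]
    by (simp add: Int_absorb1 topspace_subtopology)
  let ?V = "U \<inter> {g \<in> topspace (gtop G). grange G g \<in> U}"
  have c: "continuous_map (gtop G) (gtop G) (grange G)"
    using continuous_range by (simp add: unit_space_def continuous_map_in_subtopology)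
  have "openin (gtop G) ?V"
    using openin_continuous_map_preimage[OF c U(1)] U(1) by blast
  moreover have "x \<in> ?V" using xx U(2) by (simp add: arrows_def)
  moreover have "?V \<subseteq> units G"
  proof
    fix g assume "g \<in> ?V"
    then have "g \<in> arrows G" "g \<in> U" "grange G g \<in> U" by (auto simp: arrows_def)
    then show "g \<in> units G" using inj_onD[OF inj, of "grange G g" g] by (simp add: units_iff range_range)
  qed
  ultimately show "\<exists>T. openin (gtop G) T \<and> x \<in> T \<and> T \<subseteq> units G" by blast
qed

lemma compact_open_basis_unit_space: "has_compact_open_basis (unit_space G)"
proof -
  obtain \<B> where B: "\<And>B. B \<in> \<B> \<Longrightarrow> openin (gtop G) B \<and> compactin (gtop G) B"
      "\<And>U. openin (gtop G) U \<Longrightarrow> \<exists>\<U>\<subseteq>\<B>. U = \<Union>\<U>"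
    using compact_open_basis unfolding has_compact_open_basis_def by metis
  let ?C = "{B \<in> \<B>. B \<subseteq> units G}"
  have "\<exists>\<U>\<subseteq>?C. U = \<Union>\<U>" if "openin (unit_space G) U" for U
  proof -
    have U: "openin (gtop G) U" "U \<subseteq> units G"
      using that openin_units openin_trans_full openin_subset[OF that] topspace_unit_space
      unfolding unit_space_def by blast+
    obtain \<U> where "\<U> \<subseteq> \<B>" "U = \<Union>\<U>" using B(2)[OF U(1)] by (elim exE conjE)
    then show ?thesis using U(2) by (intro exI[of _ \<U>]) auto
  qed
  moreover have "openin (unit_space G) B \<and> compactin (unit_space G) B" if "B \<in> ?C" for B
    using that B(1) openin_open_subtopology[OF openin_units] unfolding unit_space_def
    by (auto simp: compactin_subtopology)
  ultimately have "(\<forall>B\<in>?C. openin (unit_space G) B \<and> compactin (unit_space G) B) \<and>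
      (\<forall>U. openin (unit_space G) U \<longrightarrow> (\<exists>\<U>\<subseteq>?C. U = \<Union>\<U>))"
    by (intro conjI ballI allI impI) auto
  then show ?thesis unfolding has_compact_open_basis_def by (rule exI[of _ ?C])
qed

end

section \<open>Reversal of arrows, actions and equivalences\<close>

lemma continuous_map_swap_subtopology:
  assumes "prod.swap ` A \<subseteq> B"
  shows "continuous_map (subtopology (prod_topology X Y) A) (subtopology (prod_topology Y X) B) prod.swap"
proof -
  have "continuous_map (prod_topology X Y) (prod_topology Y X) (\<lambda>w. (snd w, fst w))"
    by (simp add: continuous_map_paired continuous_map_fst continuous_map_snd)
  then have "continuous_map (prod_topology X Y) (prod_topology Y X) prod.swap"
    by (rule continuous_map_eq) auto
  with assms show ?thesis
    by (auto simp: continuous_map_in_subtopology image_subset_iff intro: continuous_map_from_subtopology)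
qed

definition opposite :: "'a top_groupoid \<Rightarrow> 'a top_groupoid" where
  "opposite G =
     \<lparr> gtop = gtop G, grange = gsource G, gsource = grange G,
       gmult = (\<lambda>g h. gmult G h g), ginv = ginv G \<rparr>"

lemma opposite_simps [simp]:
  "gtop (opposite G) = gtop G" "grange (opposite G) = gsource G" "gsource (opposite G) = grange G"
  "gmult (opposite G) g h = gmult G h g" "ginv (opposite G) = ginv G"
  by (simp_all add: opposite_def)

lemma opposite_opposite [simp]: "opposite (opposite G) = G"
  by (simp add: opposite_def)

lemma arrows_opposite [simp]: "arrows (opposite G) = arrows G"
  by (simp add: arrows_def)

lemma composable_opposite [simp]: "(g, h) \<in> composable (opposite G) \<longleftrightarrow> (h, g) \<in> composable G"
  by (auto simp: composable_def)

context groupoid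
begin

lemma groupoid_opposite: "groupoid (opposite G)"
  by unfold_locales
    (simp_all add: range_closed source_closed range_range source_range range_source source_source
      mult_closed range_mult source_mult mult_assoc range_mult_left source_mult_right
      inv_closed range_inv source_inv mult_inv_right mult_inv_left)

lemma units_opposite [simp]: "units (opposite G) = units G"
  unfolding set_eq_iff groupoid.units_iff[OF groupoid_opposite] units_iff_source by simp

lemma unit_space_opposite [simp]: "unit_space (opposite G) = unit_space G"
  by (simp add: unit_space_def)

end

lemma (in ample_groupoid) ample_groupoid_opposite: "ample_groupoid (opposite G)"
proof -
  interpret op: groupoid "opposite G" by (rule groupoid_opposite)
  show ?thesis
  proof
    let ?P = "prod_topology (gtop G) (gtop G)"
    have "continuous_map (subtopology ?P (composable (opposite G))) (subtopology ?P (composable G)) prod.swap"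
      by (rule continuous_map_swap_subtopology) (auto simp: composable_def)
    from continuous_map_compose[OF this continuous_mult]
    show "continuous_map (subtopology (prod_topology (gtop (opposite G)) (gtop (opposite G)))
        (composable (opposite G))) (gtop (opposite G)) (\<lambda>(g, h). gmult (opposite G) g h)"
      by (simp add: comp_def case_prod_unfold)
  qed (simp_all add: compact_open_basis continuous_inv Hausdorff_unit_space
      local_homeomorphism_range local_homeomorphism_source)
qed

lemma left_dom_opposite [simp]: "(h, z) \<in> left_dom (opposite H) Z q \<longleftrightarrow> (z, h) \<in> right_dom H Z q"
  by (auto simp: left_dom_def right_dom_def)

lemma right_dom_opposite [simp]: "(z, g) \<in> right_dom (opposite G) Z p \<longleftrightarrow> (g, z) \<in> left_dom G Z p"
  by (auto simp: left_dom_def right_dom_def)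

lemma homeomorphic_maps_swap_doms:
  "homeomorphic_maps (left_dom_topology (opposite H) Z q) (right_dom_topology H Z q) prod.swap prod.swap"
  unfolding homeomorphic_maps_def left_dom_topology_def right_dom_topology_def opposite_simps
  by (auto intro!: continuous_map_swap_subtopology simp: left_dom_def right_dom_def)

lemma continuous_map_swap_doms:
  "continuous_map (left_dom_topology (opposite H) Z q) T (\<lambda>(h, z). f z h) \<longleftrightarrow>
   continuous_map (right_dom_topology H Z q) T (\<lambda>(z, h). f z h)" (is "?L \<longleftrightarrow> ?R")
proof
  have s: "continuous_map (left_dom_topology (opposite H) Z q) (right_dom_topology H Z q) prod.swap"
    "continuous_map (right_dom_topology H Z q) (left_dom_topology (opposite H) Z q) prod.swap"
    using homeomorphic_maps_swap_doms unfolding homeomorphic_maps_def by blast+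
  show "?L \<Longrightarrow> ?R"
    using continuous_map_compose[OF s(2)] by (fastforce simp: comp_def case_prod_unfold)
  show "?R \<Longrightarrow> ?L"
    using continuous_map_compose[OF s(1)] by (fastforce simp: comp_def case_prod_unfold)
qed

lemma proper_map_swap_doms:
  "proper_map (left_dom_topology (opposite H) Z q) T (\<lambda>(h, z). f z h) \<longleftrightarrow>
   proper_map (right_dom_topology H Z q) T (\<lambda>(z, h). f z h)" (is "?L \<longleftrightarrow> ?R")
proof
  note h = homeomorphic_maps_swap_doms[of H Z q]
  note s = homeomorphic_imp_proper_map[OF homeomorphic_maps_imp_map[OF h]]
    homeomorphic_imp_proper_map[OF homeomorphic_maps_imp_map[OF h[unfolded homeomorphic_maps_sym[of "left_dom_topology _ _ _"]]]]
  show "?L \<Longrightarrow> ?R"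
    using proper_map_compose[OF s(2)] by (fastforce simp: comp_def case_prod_unfold)
  show "?R \<Longrightarrow> ?L"
    using proper_map_compose[OF s(1)] by (fastforce simp: comp_def case_prod_unfold)
qed

lemma left_action_opposite:
  assumes "groupoid H"
  shows "left_action (opposite H) Z q (\<lambda>h z. r z h) \<longleftrightarrow> right_action H Z q r"
proof -
  interpret groupoid H by fact
  have "(\<forall>(g, h)\<in>composable (opposite H). \<forall>z. (h, z) \<in> left_dom (opposite H) Z q \<longrightarrow>
          r z (gmult (opposite H) g h) = r (r z h) g) \<longleftrightarrow>
      (\<forall>(h, k)\<in>composable H. \<forall>z. (z, h) \<in> right_dom H Z q \<longrightarrow> r z (gmult H h k) = r (r z h) k)"
    by (auto simp: composable_def right_dom_def left_dom_def)
  moreover have "(\<forall>(g, z)\<in>left_dom (opposite H) Z q. q (r z g) = grange (opposite H) g) \<longleftrightarrow>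
      (\<forall>(z, h)\<in>right_dom H Z q. q (r z h) = gsource H h)"
    by (auto simp: right_dom_def left_dom_def)
  ultimately show ?thesis
    by (simp only: left_action_def right_action_def continuous_map_swap_doms unit_space_opposite)
qed

lemma right_action_opposite:
  assumes "groupoid G"
  shows "right_action (opposite G) Z p (\<lambda>z g. l g z) \<longleftrightarrow> left_action G Z p l"
  using left_action_opposite[OF groupoid.groupoid_opposite[OF assms], of Z p "\<lambda>z g. l g z"] by simp

lemma free_left_action_opposite:
  assumes "groupoid H"
  shows "free_left_action (opposite H) Z q (\<lambda>h z. r z h) \<longleftrightarrow> free_right_action H Z q r"
  unfolding free_left_action_def free_right_action_def groupoid.units_opposite[OF assms]
  by (auto simp: right_dom_def left_dom_def eq_commute)

lemma free_right_action_opposite: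
  assumes "groupoid G"
  shows "free_right_action (opposite G) Z p (\<lambda>z g. l g z) \<longleftrightarrow> free_left_action G Z p l"
  using free_left_action_opposite[OF groupoid.groupoid_opposite[OF assms], of Z p "\<lambda>z g. l g z"] by simp

text \<open>Both kinds of properness concern a map of the form (translate, original point), so only
  the domain has its coordinates exchanged and the target stays the same.\<close>

lemma proper_left_action_opposite:
  "proper_left_action (opposite H) Z q (\<lambda>h z. r z h) \<longleftrightarrow> proper_right_action H Z q r"
  unfolding proper_left_action_def proper_right_action_def by (rule proper_map_swap_doms)

lemma proper_right_action_opposite:
  "proper_right_action (opposite G) Z p (\<lambda>z g. l g z) \<longleftrightarrow> proper_left_action G Z p l"
  using proper_left_action_opposite[of "opposite G" Z p "\<lambda>z g. l g z"] by simp

lemma left_orbit_opposite: "left_orbit (opposite H) Z q (\<lambda>h z. r z h) = right_orbit H Z q r"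
  by (simp add: left_orbit_def right_orbit_def fun_eq_iff)

lemma right_orbit_opposite: "right_orbit (opposite G) Z p (\<lambda>z g. l g z) = left_orbit G Z p l"
  by (simp add: left_orbit_def right_orbit_def fun_eq_iff)

lemma groupoid_equivalence_opposite:
  assumes "groupoid G" "groupoid H" and E: "groupoid_equivalence G H Z p q l r"
  shows "groupoid_equivalence (opposite H) (opposite G) Z q p (\<lambda>h z. r z h) (\<lambda>z g. l g z)"
  using E
  unfolding groupoid_equivalence_def left_action_opposite[OF assms(2)] right_action_opposite[OF assms(1)]
    free_left_action_opposite[OF assms(2)] free_right_action_opposite[OF assms(1)]
    proper_left_action_opposite proper_right_action_opposite left_orbit_opposite right_orbit_opposite
    groupoid.unit_space_opposite[OF assms(1)] groupoid.unit_space_opposite[OF assms(2)]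
  by auto


section \<open>Matchings of spans of local homeomorphisms\<close>

lemma has_compact_open_basisE:
  assumes "has_compact_open_basis X" "openin X U" "x \<in> U"
  obtains A where "openin X A" "compactin X A" "x \<in> A" "A \<subseteq> U"
proof -
  obtain \<B> where B: "\<And>B. B \<in> \<B> \<Longrightarrow> openin X B \<and> compactin X B"
      "\<And>U. openin X U \<Longrightarrow> \<exists>\<U>\<subseteq>\<B>. U = \<Union>\<U>"
    using assms(1) unfolding has_compact_open_basis_def by metis
  obtain \<U> where "\<U> \<subseteq> \<B>" "U = \<Union>\<U>" using B(2)[OF assms(2)] by blast
  with assms(3) obtain A where "A \<in> \<U>" "A \<in> \<B>" "x \<in> A" "A \<subseteq> U" by blast
  with B(1) that show ?thesis by blast
qed

lemma homeomorphic_map_open_restriction: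
  assumes "continuous_map X Y f" "open_map X Y f" "openin X U" "inj_on f U"
  shows "homeomorphic_map (subtopology X U) (subtopology Y (f ` U)) f"
proof -
  have U: "U \<subseteq> topspace X" by (rule openin_subset[OF assms(3)])
  have V: "f ` U \<subseteq> topspace Y"
    using assms(1) U continuous_map_image_subset_topspace by fastforce
  show ?thesis
  proof (rule bijective_open_imp_homeomorphic_map)
    show "continuous_map (subtopology X U) (subtopology Y (f ` U)) f"
      using assms(1) by (auto simp: continuous_map_in_subtopology continuous_map_from_subtopology)
    show "open_map (subtopology X U) (subtopology Y (f ` U)) f"
      by (rule open_map_into_subtopology[OF open_map_from_subtopology[OF assms(2,3)]]) auto
    show "f ` topspace (subtopology X U) = topspace (subtopology Y (f ` U))"
      using U V by (auto simp: topspace_subtopology)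
    show "inj_on f (topspace (subtopology X U))"
      using assms(4) by (auto simp: inj_on_def)
  qed
qed

text \<open>An equivalence is reduced to a span with two open legs that are locally injective at the
  same time. All separation and compactness assumptions concern \<open>X\<close> and
  \<open>Y\<close>. They are symmetric in the two legs, so \<open>flip\<close> transfers each result
  from \<open>p\<close> to \<open>q\<close>.\<close>

locale bisection_span =
  fixes Z :: "'z topology" and X :: "'x topology" and Y :: "'y topology"
    and p :: "'z \<Rightarrow> 'x" and q :: "'z \<Rightarrow> 'y"
  assumes cont_p: "continuous_map Z X p" and open_p: "open_map Z X p"
    and surj_p: "p ` topspace Z = topspace X"
    and cont_q: "continuous_map Z Y q" and open_q: "open_map Z Y q"
    and surj_q: "q ` topspace Z = topspace Y"
    and locally_inj: "z \<in> topspace Z \<Longrightarrow> \<exists>U. openin Z U \<and> z \<in> U \<and> inj_on p U \<and> inj_on q U"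
    and Hausdorff_X: "Hausdorff_space X" and Hausdorff_Y: "Hausdorff_space Y"
    and basis_X: "has_compact_open_basis X" and basis_Y: "has_compact_open_basis Y"
    and sigma_X: "sigma_compact_space X" and sigma_Y: "sigma_compact_space Y"
begin

lemma flip: "bisection_span Z Y X q p"
  using bisection_span_axioms unfolding bisection_span_def by blast

definition bisection :: "'z set \<Rightarrow> bool" where
  "bisection U \<longleftrightarrow> openin Z U \<and> compactin Z U \<and> inj_on p U \<and> inj_on q U"

text \<open>Compactness is imported from \<open>X\<close>: on a small open set \<open>p\<close> is a
  homeomorphism onto an open set, and a compact open neighbourhood inside that image is lifted back
  to \<open>Z\<close>.\<close>

lemma bisection_around:
  assumes "z \<in> topspace Z"
  obtains U where "bisection U" "z \<in> U"
proof -
  obtain U where U: "openin Z U" "z \<in> U" "inj_on p U" "inj_on q U"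
    using locally_inj[OF assms] by blast
  have "openin X (p ` U)" using open_p U(1) by (simp add: open_map_def)
  then obtain A where A: "openin X A" "compactin X A" "p z \<in> A" "A \<subseteq> p ` U"
    using has_compact_open_basisE[OF basis_X] U(2) by (metis imageI)
  define U' where "U' = U \<inter> {z \<in> topspace Z. p z \<in> A}"
  have op: "openin Z U'"
    unfolding U'_def using U(1) openin_continuous_map_preimage[OF cont_p A(1)] by blast
  have inj: "inj_on p U'" "inj_on q U'"
    using U by (auto simp: U'_def inj_on_def)
  have im: "p ` U' = A"
    using A(4) openin_subset[OF U(1)] by (auto simp: U'_def)
  have "homeomorphic_map (subtopology Z U') (subtopology X A) p"
    using homeomorphic_map_open_restriction[OF cont_p open_p op inj(1)] im by simp
  then have "compact_space (subtopology Z U')"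
    using A(2) homeomorphic_compact_space homeomorphic_map_imp_homeomorphic_space
      compactin_subspace by metis
  then have "compactin Z U'"
    using op openin_subset by (auto simp: compactin_subspace)
  with op inj have "bisection U'" by (simp add: bisection_def)
  moreover have "z \<in> U'" using assms U A by (simp add: U'_def)
  ultimately show ?thesis by (rule that)
qed

lemma bisection_mono:
  assumes "bisection U" "openin Z U'" "closedin Z U'"
  shows "bisection (U \<inter> U')"
  using assms by (auto simp: bisection_def inj_on_def intro: compact_Int_closedin)

text \<open>A bisection may fail to be closed in \<open>Z\<close>, but cutting it down by a clopen
  \<open>C\<close> keeps it compact, and the image of a compact set in the Hausdorff space
  \<open>X\<close> is closed. The image is open because \<open>p\<close> is an open map. This is the
  inductive step for the clopenness of the levels below.\<close>

lemma bisection_image_clopen: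
  assumes "bisection U" "openin Y C" "closedin Y C"
  shows "openin X (p ` {z \<in> U. q z \<in> C})" "closedin X (p ` {z \<in> U. q z \<in> C})"
proof -
  let ?C = "{z \<in> topspace Z. q z \<in> C}"
  have eq: "{z \<in> U. q z \<in> C} = U \<inter> ?C"
    using assms(1) openin_subset by (auto simp: bisection_def)
  have "bisection (U \<inter> ?C)"
    using assms openin_continuous_map_preimage[OF cont_q] closedin_continuous_map_preimage[OF cont_q]
    by (blast intro: bisection_mono)
  then show "openin X (p ` {z \<in> U. q z \<in> C})" "closedin X (p ` {z \<in> U. q z \<in> C})"
    using open_p compactin_imp_closedin[OF Hausdorff_X image_compactin[OF _ cont_p]]
    by (auto simp: eq bisection_def open_map_def)
qed

lemma bisection_range_clopen:
  assumes "bisection U"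
  shows "openin X (p ` U)" "closedin X (p ` U)"
  using assms open_p compactin_imp_closedin[OF Hausdorff_X image_compactin[OF _ cont_p]]
  by (auto simp: bisection_def open_map_def)

lemma bisection_empty: "bisection {}"
  by (simp add: bisection_def)

text \<open>Finitely many bisections suffice over each compact piece of \<open>X\<close>, so
  sigma-compactness leaves countably many in all.\<close>

lemma bisection_cover:
  "\<exists>U :: nat \<Rightarrow> 'z set. (\<forall>n. bisection (U n)) \<and> topspace X = (\<Union>n. p ` U n)"
proof -
  obtain \<K> where K: "countable \<K>" "\<And>K. K \<in> \<K> \<Longrightarrow> compactin X K" "\<Union>\<K> = topspace X"
    using sigma_X unfolding sigma_compact_space_def by metis
  let ?B = "(\<lambda>U. p ` U) ` {U. bisection U}"
  have "\<exists>\<F>. finite \<F> \<and> \<F> \<subseteq> {U. bisection U} \<and> K \<subseteq> (\<Union>U\<in>\<F>. p ` U)" if K': "K \<in> \<K>" for K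
  proof -
    have op: "openin X V" if "V \<in> ?B" for V
      using that bisection_range_clopen by blast
    have "K \<subseteq> \<Union>?B"
    proof
      fix x assume "x \<in> K"
      then have "x \<in> p ` topspace Z" using K(3) K' surj_p by auto
      then obtain z where z: "z \<in> topspace Z" "p z = x" by auto
      obtain U where "bisection U" "z \<in> U" by (rule bisection_around[OF z(1)])
      with z(2) show "x \<in> \<Union>?B" by blast
    qed
    then have "\<exists>\<F>. finite \<F> \<and> \<F> \<subseteq> ?B \<and> K \<subseteq> \<Union>\<F>"
      using op by (intro compactinD[OF K(2)[OF K']])
    then obtain \<F> where "finite \<F>" "\<F> \<subseteq> ?B" "K \<subseteq> \<Union>\<F>" by (elim exE conjE)
    then show ?thesis using finite_subset_image[of \<F> "\<lambda>U. p ` U"] by metis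
  qed
  then obtain \<F> where F: "\<And>K. K \<in> \<K> \<Longrightarrow> finite (\<F> K)"
      "\<And>K U. \<lbrakk>K \<in> \<K>; U \<in> \<F> K\<rbrakk> \<Longrightarrow> bisection U"
      "\<And>K. K \<in> \<K> \<Longrightarrow> K \<subseteq> (\<Union>U\<in>\<F> K. p ` U)"
    unfolding subset_iff mem_Collect_eq by metis
  \<comment> \<open>The empty bisection keeps the family nonempty, as an enumeration by all natural
    numbers requires; \<open>X\<close> may be empty.\<close>
  let ?C = "insert {} (\<Union>K\<in>\<K>. \<F> K)"
  have "countable ?C"
    using K(1) F(1) by (auto intro: countable_finite)
  define U where "U = from_nat_into ?C"
  have U: "range U = ?C"
    unfolding U_def by (rule range_from_nat_into) (simp, fact)
  have b: "bisection (U n)" for n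
  proof -
    have "U n \<in> ?C" using U by blast
    then show ?thesis using F(2) bisection_empty by auto
  qed
  moreover have "topspace X = (\<Union>n. p ` U n)"
  proof
    show "(\<Union>n. p ` U n) \<subseteq> topspace X"
      using bisection_range_clopen(1)[OF b] by (auto dest: openin_subset)
    show "topspace X \<subseteq> (\<Union>n. p ` U n)"
    proof
      fix x assume "x \<in> topspace X"
      then obtain K where K: "K \<in> \<K>" "x \<in> K" using K(3) by blast
      then obtain V where "V \<in> \<F> K" "x \<in> p ` V" using F(3)[OF K(1)] by auto
      moreover then have "V \<in> range U" using U K(1) by blast
      ultimately show "x \<in> (\<Union>n. p ` U n)" by blast
    qed
  qed
  ultimately show ?thesis by (intro exI[of _ U]) simp
qed

text \<open>Earlier images are removed from later ones, which preserves bisections because these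
  images are clopen in \<open>X\<close>. Only the images under \<open>p\<close> become disjoint.
  Those under \<open>q\<close> may still overlap, and the index \<open>n\<close> will be recorded in
  the target level to separate them.\<close>

lemma bisection_partition:
  "\<exists>U :: nat \<Rightarrow> 'z set. (\<forall>n. bisection (U n)) \<and> (\<forall>x \<in> topspace X. \<exists>!n. x \<in> p ` U n)"
proof -
  obtain U :: "nat \<Rightarrow> 'z set" where U: "\<And>n. bisection (U n)" "topspace X = (\<Union>n. p ` U n)"
    using bisection_cover by metis
  define D where "D n = topspace X - (\<Union>k<n. p ` U k)" for n
  have D: "openin X (D n)" "closedin X (D n)" for n
    unfolding D_def using bisection_range_clopen[OF U(1)]
    by (auto intro!: closedin_Union)
  define U' where "U' n = U n \<inter> {z \<in> topspace Z. p z \<in> D n}" for n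
  have "bisection (U' n)" for n
    unfolding U'_def
    by (intro bisection_mono U openin_continuous_map_preimage[OF cont_p]
        closedin_continuous_map_preimage[OF cont_p] D)
  moreover have "\<exists>!n. x \<in> p ` U' n" if x: "x \<in> topspace X" for x
  proof -
    have im: "x \<in> p ` U' n \<longleftrightarrow> x \<in> p ` U n \<and> (\<forall>k<n. x \<notin> p ` U k)" for n
      using openin_subset[of Z "U n"] U(1)[of n] x by (auto simp: U'_def D_def bisection_def)
    obtain n where "x \<in> p ` U n" using x U(2) by blast
    then have "x \<in> p ` U' (LEAST n. x \<in> p ` U n)"
      unfolding im using LeastI not_less_Least by (metis (mono_tags, lifting))
    then show ?thesis using im by (metis linorder_neqE_nat)
  qed
  ultimately show ?thesis by (intro exI[of _ U']) simp
qed

end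

text \<open>The Cantor--Schroeder--Bernstein decomposition: \<open>csb_left i\<close> is the part of level \<open>i\<close> of
  \<open>X \<times> \<nat>\<close> that is matched through the bisections \<open>U\<close>, and \<open>csb_right j\<close> is its image in level \<open>j\<close>
  of \<open>Y \<times> \<nat>\<close>. Both embeddings strictly raise the level, so each level of the decomposition
  depends only on earlier ones and is clopen by induction; this fails for two arbitrary embeddings.\<close>

inductive csb_left and csb_right
  for X :: "'x topology" and p :: "'z \<Rightarrow> 'x" and q :: "'z \<Rightarrow> 'y" and U V :: "nat \<Rightarrow> 'z set"
  where
    left: "\<lbrakk>x \<in> topspace X;
        \<And>m j z. \<lbrakk>i = Suc (prod_encode (m, j)); z \<in> V m; p z = x\<rbrakk> \<Longrightarrow> csb_right X p q U V j (q z)\<rbrakk>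
      \<Longrightarrow> csb_left X p q U V i x"
  | right: "\<lbrakk>z \<in> U n; csb_left X p q U V i (p z)\<rbrakk>
      \<Longrightarrow> csb_right X p q U V (Suc (prod_encode (n, i))) (q z)"

text \<open>If \<open>p\<close> and \<open>q\<close> are continuous and open, this is the graph of a
  homeomorphism between \<open>X \<times> \<nat>\<close> and \<open>Y \<times> \<nat>\<close> in
  which every matched pair comes with a point of \<open>Z\<close> over it. The point is kept because
  arrows are transported along it.\<close>

definition is_matching ::
    "'z topology \<Rightarrow> 'x topology \<Rightarrow> 'y topology \<Rightarrow> ('z \<Rightarrow> 'x) \<Rightarrow> ('z \<Rightarrow> 'y) \<Rightarrow> ('z \<times> nat \<times> nat) set \<Rightarrow> bool"
  where
  "is_matching Z X Y p q W \<longleftrightarrow>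
     openin (prod_topology Z (discrete_topology UNIV)) W \<and>
     (\<forall>x \<in> topspace X. \<forall>i. \<exists>!(z, j). (z, i, j) \<in> W \<and> p z = x) \<and>
     (\<forall>y \<in> topspace Y. \<forall>j. \<exists>!(z, i). (z, i, j) \<in> W \<and> q z = y)"

lemma ex1_pairI:
  assumes "P a b" "\<And>x y. P x y \<Longrightarrow> x = a \<and> y = b"
  shows "\<exists>!(x, y). P x y"
proof (rule ex1I[of _ "(a, b)"])
  fix w assume "case w of (x, y) \<Rightarrow> P x y"
  then show "w = (a, b)" using assms(2) by (cases w) auto
qed (use assms(1) in simp)

lemma is_matching_flip:
  assumes "is_matching Z X Y p q W"
  shows "is_matching Z Y X q p {(z, j, i). (z, i, j) \<in> W}"
proof -
  let ?P = "prod_topology Z (discrete_topology UNIV)" and ?f = "\<lambda>(z, j, i). (z, i, j)"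
  have W: "openin ?P W" using assms by (simp add: is_matching_def)
  have "continuous_map ?P ?P ?f"
  proof -
    have "continuous_map ?P ?P (\<lambda>w. (fst w, prod.swap (snd w)))"
      by (auto intro!: continuous_map_pairedI continuous_map_fst
          continuous_map_compose[OF continuous_map_snd, unfolded comp_def])
    then show ?thesis by (rule continuous_map_eq) auto
  qed
  from openin_continuous_map_preimage[OF this W] have "openin ?P {w \<in> topspace ?P. ?f w \<in> W}" .
  moreover have "{w \<in> topspace ?P. ?f w \<in> W} = {(z, j, i). (z, i, j) \<in> W}"
    using openin_subset[OF W] by auto
  ultimately have "openin ?P {(z, j, i). (z, i, j) \<in> W}" by simp
  then show ?thesis
    using assms unfolding is_matching_def mem_Collect_eq case_prod_conv by (elim conjE, intro conjI)
qed

context bisection_span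
begin

text \<open>The pieces \<open>U n\<close> embed \<open>X \<times> \<nat>\<close> into
  \<open>Y \<times> \<nat>\<close> by sending \<open>(p z, i)\<close> to
  \<open>(q z, Suc (prod_encode (n, i)))\<close>, and the pieces \<open>V m\<close> embed in the
  other direction. The first embedding is used on \<open>S\<close> and the inverse of the second one
  off \<open>S\<close>.\<close>

lemma matching_exists: "\<exists>W. is_matching Z X Y p q W"
proof -
  interpret f: bisection_span Z Y X q p by (rule flip)
  have fb: "f.bisection U \<longleftrightarrow> bisection U" for U
    by (auto simp: bisection_def f.bisection_def)
  obtain U :: "nat \<Rightarrow> 'z set" where "(\<forall>n. bisection (U n)) \<and> (\<forall>x \<in> topspace X. \<exists>!n. x \<in> p ` U n)"
    using bisection_partition ..
  then have U: "\<And>n. bisection (U n)" "\<And>x. x \<in> topspace X \<Longrightarrow> \<exists>!n. x \<in> p ` U n" by simp_all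
  obtain V :: "nat \<Rightarrow> 'z set" where "(\<forall>n. bisection (V n)) \<and> (\<forall>y \<in> topspace Y. \<exists>!n. y \<in> q ` V n)"
    using f.bisection_partition unfolding fb ..
  then have V: "\<And>n. bisection (V n)" "\<And>y. y \<in> topspace Y \<Longrightarrow> \<exists>!n. y \<in> q ` V n" by simp_all
  define S where "S i = Collect (csb_left X p q U V i)" for i
  define T where "T i = Collect (csb_right X p q U V i)" for i
  have UZ: "z \<in> topspace Z" if "z \<in> U n" for z n
    using U(1)[of n] that openin_subset by (auto simp: bisection_def)
  have VZ: "z \<in> topspace Z" if "z \<in> V n" for z n
    using V(1)[of n] that openin_subset by (auto simp: bisection_def)
  \<comment> \<open>The successor in the target level keeps level 0 out of both images. Hence all of
    \<open>X\<close> at level 0 is matched through \<open>U\<close>, and nothing of \<open>Y\<close>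
    at level 0 is.\<close>
  have S0: "S 0 = topspace X" by (auto simp: S_def csb_left.simps[of _ _ _ _ _ 0])
  have T0: "T 0 = {}" by (auto simp: T_def csb_right.simps[of _ _ _ _ _ 0])
  \<comment> \<open>A point leaves \<open>S\<close> exactly when it is the image, through
    \<open>V m\<close>, of a point at level \<open>j\<close> outside \<open>T j\<close>. The code of
    the level determines \<open>m\<close> and \<open>j\<close>, so a single piece is
    involved.\<close>
  have SSuc: "S (Suc (prod_encode (m, j))) = topspace X - p ` {z \<in> V m. q z \<in> topspace Y - T j}" for m j
    using VZ continuous_map_image_subset_topspace[OF cont_q]
    by (force simp: S_def T_def csb_left.simps[of _ _ _ _ _ "Suc k" for k])
  have TSuc: "T (Suc (prod_encode (n, i))) = q ` {z \<in> U n. p z \<in> S i}" for n i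
    by (auto simp: S_def T_def csb_right.simps[of _ _ _ _ _ "Suc k" for k])
  have clopen: "openin X (S i) \<and> closedin X (S i) \<and> openin Y (T i) \<and> closedin Y (T i)" for i
  proof (induction i rule: less_induct)
    case (less i)
    show ?case
    proof (cases i)
      case 0
      then show ?thesis by (simp add: S0 T0)
    next
      case (Suc k)
      obtain m j where k: "k = prod_encode (m, j)" by (metis prod_decode_inverse surj_pair)
      \<comment> \<open>A component is at most its code, so the successor makes the level drop
        strictly.\<close>
      then have i: "i = Suc (prod_encode (m, j))" and "j < i"
        using Suc le_prod_encode_2[of j m] by auto
      then have IH: "openin X (S j)" "closedin X (S j)" "openin Y (T j)" "closedin Y (T j)"
        using less by auto
      then have "openin Y (topspace Y - T j)" "closedin Y (topspace Y - T j)" by auto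
      from bisection_image_clopen[OF V(1) this] f.bisection_image_clopen[of "U m" "S j"] U(1) IH
      show ?thesis by (auto simp: i SSuc TSuc fb)
    qed
  qed
  \<comment> \<open>By \<open>TSuc\<close> an edge through \<open>U\<close> joins \<open>S\<close>
    to \<open>T\<close>, and by \<open>SSuc\<close> an edge through \<open>V\<close> joins the
    complements. The two kinds therefore never compete for a point.\<close>
  define W where "W = {(z, i, j). (\<exists>n. z \<in> U n \<and> j = Suc (prod_encode (n, i)) \<and> p z \<in> S i) \<or>
      (\<exists>m. z \<in> V m \<and> i = Suc (prod_encode (m, j)) \<and> q z \<in> topspace Y - T j)}"
  have inj: "inj_on p (U n)" "inj_on q (U n)" "inj_on p (V n)" "inj_on q (V n)" for n
    using U(1)[of n] V(1)[of n] by (auto simp: bisection_def)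
  have W: "openin (prod_topology Z (discrete_topology UNIV)) W"
  proof -
    have 1: "openin Z {z \<in> U n. p z \<in> S i}" for n i
    proof -
      have "{z \<in> U n. p z \<in> S i} = U n \<inter> {z \<in> topspace Z. p z \<in> S i}" using UZ by auto
      then show ?thesis
        using U(1)[of n] clopen openin_continuous_map_preimage[OF cont_p] by (auto simp: bisection_def)
    qed
    have 2: "openin Z {z \<in> V n. q z \<in> topspace Y - T i}" for n i
    proof -
      have "{z \<in> V n. q z \<in> topspace Y - T i} = V n \<inter> {z \<in> topspace Z. q z \<in> topspace Y - T i}" using VZ by auto
      then show ?thesis
        using V(1)[of n] clopen openin_continuous_map_preimage[OF cont_q, of "topspace Y - T i"]
        by (auto simp: bisection_def)
    qed
    have "W = (\<Union>(n, i). {z \<in> U n. p z \<in> S i} \<times> {(i, Suc (prod_encode (n, i)))}) \<union>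
        (\<Union>(m, j). {z \<in> V m. q z \<in> topspace Y - T j} \<times> {(Suc (prod_encode (m, j)), j)})"
      by (auto simp: W_def)
    then show ?thesis
      using 1 2 by (auto intro!: openin_Un openin_Union simp: openin_prod_Times_iff)
  qed
  have W1: "\<exists>!(z, j). (z, i, j) \<in> W \<and> p z = x" if x: "x \<in> topspace X" for x i
  proof (cases "x \<in> S i")
    case True
    obtain n where n: "x \<in> p ` U n" "\<And>n'. x \<in> p ` U n' \<Longrightarrow> n' = n" using U(2)[OF x] by blast
    then obtain z where z: "z \<in> U n" "p z = x" by blast
    have A: "(z, i, Suc (prod_encode (n, i))) \<in> W" using z True by (auto simp: W_def)
    have B: "z' = z \<and> j' = Suc (prod_encode (n, i))" if *: "(z', i, j') \<in> W" "p z' = x" for z' j'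
    proof -
      have "\<not> (z' \<in> V m \<and> i = Suc (prod_encode (m, j')) \<and> q z' \<in> topspace Y - T j')" for m
        using True *(2) by (auto simp: SSuc)
      then obtain n' where "z' \<in> U n'" "j' = Suc (prod_encode (n', i))"
        using *(1) unfolding W_def by blast
      moreover from this have "n' = n" using n(2)[of n'] *(2) by auto
      ultimately show ?thesis using inj_onD[OF inj(1)] z *(2) by simp
    qed
    show ?thesis by (rule ex1_pairI, rule conjI, rule A, rule z(2), erule conjE, rule B)
  next
    case False
    then obtain k where k: "i = Suc k" using x S0 by (cases i) auto
    \<comment> \<open>Off \<open>S\<close> the level itself records the piece \<open>V m\<close> and
      the level \<open>j\<close> at the other end, so injectivity of \<open>p\<close> on that piece
      settles uniqueness. On \<open>S\<close> it is the partition by \<open>U\<close> that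
      determines the piece.\<close>
    obtain m j where mj: "k = prod_encode (m, j)" by (metis prod_decode_inverse surj_pair)
    from False x obtain z where z: "z \<in> V m" "q z \<in> topspace Y - T j" "p z = x"
      unfolding k mj SSuc by blast
    have A: "(z, i, j) \<in> W" using z k mj by (auto simp: W_def)
    have B: "z' = z \<and> j' = j" if "(z', i, j') \<in> W" "p z' = x" for z' j'
    proof -
      from that False have "z' \<in> V m \<and> j' = j" by (auto simp: W_def k mj)
      with z that(2) inj(3) show ?thesis by (metis inj_onD)
    qed
    show ?thesis by (rule ex1_pairI, rule conjI, rule A, rule z(3), erule conjE, rule B)
  qed
  have W2: "\<exists>!(z, i). (z, i, j) \<in> W \<and> q z = y" if y: "y \<in> topspace Y" for y j
  proof (cases "y \<in> T j")
    case False
    obtain n where n: "y \<in> q ` V n" "\<And>n'. y \<in> q ` V n' \<Longrightarrow> n' = n" using V(2)[OF y] by blast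
    then obtain z where z: "z \<in> V n" "q z = y" by blast
    have A: "(z, Suc (prod_encode (n, j)), j) \<in> W" using z False y by (auto simp: W_def)
    have B: "z' = z \<and> i' = Suc (prod_encode (n, j))" if *: "(z', i', j) \<in> W" "q z' = y" for z' i'
    proof -
      have "\<not> (z' \<in> U n \<and> j = Suc (prod_encode (n, i')) \<and> p z' \<in> S i')" for n
        using False *(2) by (auto simp: TSuc)
      then obtain n' where "z' \<in> V n'" "i' = Suc (prod_encode (n', j))"
        using *(1) unfolding W_def by blast
      moreover from this have "n' = n" using n(2)[of n'] *(2) by auto
      ultimately show ?thesis using inj_onD[OF inj(4)] z *(2) by simp
    qed
    show ?thesis by (rule ex1_pairI, rule conjI, rule A, rule z(2), erule conjE, rule B)
  next
    case True
    then obtain k where k: "j = Suc k" using T0 by (cases j) auto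
    obtain n i where ni: "k = prod_encode (n, i)" by (metis prod_decode_inverse surj_pair)
    from True obtain z where z: "z \<in> U n" "p z \<in> S i" "q z = y"
      unfolding k ni TSuc by blast
    have A: "(z, i, j) \<in> W" using z k ni by (auto simp: W_def)
    have B: "z' = z \<and> i' = i" if "(z', i', j) \<in> W" "q z' = y" for z' i'
    proof -
      from that True have "z' \<in> U n \<and> i' = i" by (auto simp: W_def k ni)
      with z that(2) inj(2) show ?thesis by (metis inj_onD)
    qed
    show ?thesis by (rule ex1_pairI, rule conjI, rule A, rule z(3), erule conjE, rule B)
  qed
  show ?thesis
    unfolding is_matching_def by (intro exI[of _ W] conjI ballI allI W W1 W2)
qed

end


section \<open>Principal actions\<close>

text \<open>This is a principal \<open>H\<close>-bundle over \<open>X\<close>. An equivalence gives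
  one for \<open>H\<close> over \<open>unit_space G\<close> and, after reversal, one for
  \<open>opposite G\<close> over \<open>unit_space H\<close>; keeping \<open>X\<close> arbitrary
  lets both be instances.\<close>

locale principal_right = ample_groupoid H for H :: "'b top_groupoid" +
  fixes Z :: "'z topology" and q :: "'z \<Rightarrow> 'b" and r :: "'z \<Rightarrow> 'b \<Rightarrow> 'z"
    and X :: "'x topology" and p :: "'z \<Rightarrow> 'x"
  assumes action: "right_action H Z q r"
    and free: "free_right_action H Z q r"
    and proper: "proper_right_action H Z q r"
    and quotient: "induces_homeomorphism Z (right_orbit H Z q r) X p"
begin

lemma quotient_map_p: "quotient_map Z X p"
  using quotient by (simp add: induces_homeomorphism_iff)

lemma continuous_p: "continuous_map Z X p"
  by (rule quotient_imp_continuous_map[OF quotient_map_p])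

lemma surj_p: "p ` topspace Z = topspace X"
  by (rule quotient_imp_surjective_map[OF quotient_map_p])

lemma continuous_q: "continuous_map Z (unit_space H) q"
  using action by (simp add: right_action_def)

lemma anchor_unit: "z \<in> topspace Z \<Longrightarrow> q z \<in> units H"
  using continuous_map_image_subset_topspace[OF continuous_q] topspace_unit_space by auto

lemma anchor_arrow: "z \<in> topspace Z \<Longrightarrow> q z \<in> arrows H" "z \<in> topspace Z \<Longrightarrow> grange H (q z) = q z"
  "z \<in> topspace Z \<Longrightarrow> gsource H (q z) = q z"
  using anchor_unit units_iff units_iff_source by blast+

lemma continuous_act: "continuous_map (right_dom_topology H Z q) Z (\<lambda>(z, h). r z h)"
  using action by (simp add: right_action_def)

lemma in_domI: "\<lbrakk>z \<in> topspace Z; h \<in> arrows H; grange H h = q z\<rbrakk> \<Longrightarrow> (z, h) \<in> right_dom H Z q"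
  by (simp add: right_dom_def)

lemma in_domD: "(z, h) \<in> right_dom H Z q \<Longrightarrow> z \<in> topspace Z"
  "(z, h) \<in> right_dom H Z q \<Longrightarrow> h \<in> arrows H"
  "(z, h) \<in> right_dom H Z q \<Longrightarrow> q z = grange H h"
  by (simp_all add: right_dom_def)

lemma act_closed: "(z, h) \<in> right_dom H Z q \<Longrightarrow> r z h \<in> topspace Z"
  by (rule right_action_closed[OF action])

lemma anchor_act: "(z, h) \<in> right_dom H Z q \<Longrightarrow> q (r z h) = gsource H h"
  using action unfolding right_action_def by blast

lemma act_unit: "z \<in> topspace Z \<Longrightarrow> r z (q z) = z"
  using action unfolding right_action_def by blast

lemma act_mult:
  "\<lbrakk>(z, h) \<in> right_dom H Z q; (h, k) \<in> composable H\<rbrakk> \<Longrightarrow> r z (gmult H h k) = r (r z h) k"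
  using action unfolding right_action_def by blast

lemma act_inv_dom: "(z, h) \<in> right_dom H Z q \<Longrightarrow> (r z h, ginv H h) \<in> right_dom H Z q"
  using act_closed anchor_act by (simp add: right_dom_def inv_closed range_inv)

lemma act_inv: "(z, h) \<in> right_dom H Z q \<Longrightarrow> r (r z h) (ginv H h) = z"
proof -
  assume d: "(z, h) \<in> right_dom H Z q"
  have "(h, ginv H h) \<in> composable H"
    using in_domD[OF d] by (simp add: composable_def inv_closed range_inv)
  from act_mult[OF d this] have "r (r z h) (ginv H h) = r z (q z)"
    by (simp add: mult_inv_right[OF in_domD(2)[OF d]] in_domD(3)[OF d])
  then show ?thesis by (simp add: act_unit in_domD(1)[OF d])
qed

text \<open>If \<open>h\<close> and \<open>k\<close> move \<open>z\<close> to the same point, then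
  \<open>h k^-1\<close> fixes \<open>z\<close> and is a unit by freeness.\<close>

lemma act_injective:
  assumes "(z, h) \<in> right_dom H Z q" "(z, k) \<in> right_dom H Z q" "r z h = r z k"
  shows "h = k"
proof -
  have s: "gsource H h = gsource H k" using anchor_act[OF assms(1)] anchor_act[OF assms(2)] assms(3) by simp
  have c: "(h, ginv H k) \<in> composable H"
    using in_domD[OF assms(1)] in_domD[OF assms(2)] s by (simp add: composable_def inv_closed range_inv)
  have "r z (gmult H h (ginv H k)) = z"
    using act_mult[OF assms(1) c] act_inv[OF assms(2)] assms(3) by simp
  moreover have "(z, gmult H h (ginv H k)) \<in> right_dom H Z q"
    using in_domD[OF assms(1)] by (simp add: right_dom_def mult_closed[OF c] range_mult[OF c])
  ultimately have "gmult H h (ginv H k) \<in> units H"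
    using free unfolding free_right_action_def by fast
  then show ?thesis
    using eq_if_mult_inv_unit in_domD[OF assms(1)] in_domD[OF assms(2)] s by blast
qed

lemma self_in_orbit: "z \<in> topspace Z \<Longrightarrow> z \<in> right_orbit H Z q r z"
proof -
  assume z: "z \<in> topspace Z"
  then have "(z, q z) \<in> right_dom H Z q" by (intro in_domI) (simp_all add: anchor_arrow)
  then show ?thesis unfolding right_orbit_def using act_unit[OF z] by force
qed

text \<open>Translation by \<open>h\<close> can only shrink an orbit, and translation back by the
  inverse shows that it does not shrink; \<open>p\<close> depends only on the orbit.\<close>

lemma p_act: "(z, h) \<in> right_dom H Z q \<Longrightarrow> p (r z h) = p z"
proof -
  assume d: "(z, h) \<in> right_dom H Z q"
  have sub: "right_orbit H Z q r (r z h) \<subseteq> right_orbit H Z q r z" if d: "(z, h) \<in> right_dom H Z q" for z h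
  proof
    fix w assume "w \<in> right_orbit H Z q r (r z h)"
    then obtain k where k: "w = r (r z h) k" "(r z h, k) \<in> right_dom H Z q"
      unfolding right_orbit_def by blast
    then have c: "(h, k) \<in> composable H"
      using in_domD[OF d] in_domD[OF k(2)] anchor_act[OF d] by (simp add: composable_def)
    have "(z, gmult H h k) \<in> right_dom H Z q"
      using in_domD[OF d] by (simp add: right_dom_def mult_closed[OF c] range_mult[OF c])
    then show "w \<in> right_orbit H Z q r z"
      unfolding right_orbit_def using k(1) act_mult[OF d c] by force
  qed
  have "right_orbit H Z q r z \<subseteq> right_orbit H Z q r (r z h)"
    using sub[OF act_inv_dom[OF d]] by (simp add: act_inv d)
  with sub[OF d] have "right_orbit H Z q r z = right_orbit H Z q r (r z h)" by blast
  then show ?thesis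
    using quotient act_closed[OF d] in_domD(1)[OF d] by (simp add: induces_homeomorphism_iff)
qed

lemma same_orbit:
  assumes "z \<in> topspace Z" "w \<in> topspace Z" "p z = p w"
  obtains h where "(z, h) \<in> right_dom H Z q" "r z h = w"
proof -
  have "right_orbit H Z q r z = right_orbit H Z q r w"
    using quotient assms by (simp add: induces_homeomorphism_iff)
  then have "w \<in> right_orbit H Z q r z" using self_in_orbit[OF assms(2)] by simp
  then show ?thesis using that unfolding right_orbit_def by blast
qed

text \<open>The saturation of an open set is open because a local section of \<open>grange H\<close> through \<open>h\<close>
  extends \<open>z \<mapsto> r z h\<close> to a neighbourhood.\<close>

lemma open_p: "open_map Z X p"
  unfolding open_map_def
proof (intro allI impI)
  fix U assume U: "openin Z U"
  have UZ: "U \<subseteq> topspace Z" by (rule openin_subset[OF U])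
  have "openin Z {z \<in> topspace Z. p z \<in> p ` U}"
  proof (subst openin_subopen, clarify)
    fix z u assume z: "z \<in> topspace Z" and u: "u \<in> U" "p z = p u"
    obtain h where h: "(z, h) \<in> right_dom H Z q" "r z h = u"
      using same_orbit[OF z _ u(2)] u(1) UZ by blast
    obtain B where B: "openin (gtop H) B" "h \<in> B" "openin (unit_space H) (grange H ` B)"
      "homeomorphic_map (subtopology (gtop H) B) (subtopology (unit_space H) (grange H ` B)) (grange H)"
      using local_homeomorphism_range in_domD(2)[OF h(1)]
      unfolding local_homeomorphism_def arrows_def by blast
    obtain s where s: "homeomorphic_maps (subtopology (gtop H) B)
        (subtopology (unit_space H) (grange H ` B)) (grange H) s"
      using B(4) unfolding homeomorphic_map_maps by (elim exE)
    have BH: "B \<subseteq> topspace (gtop H)" by (rule openin_subset[OF B(1)])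
    have sr: "s (grange H b) = b" if "b \<in> B" for b
      using s that BH unfolding homeomorphic_maps_def by auto
    define N where "N = {w \<in> topspace Z. q w \<in> grange H ` B}"
    have N: "openin Z N"
      unfolding N_def by (rule openin_continuous_map_preimage[OF continuous_q B(3)])
    have NZ: "topspace (subtopology Z N) = N" using openin_subset[OF N] by auto
    have "continuous_map (subtopology Z N) (subtopology (unit_space H) (grange H ` B)) q"
      by (rule continuous_map_into_subtopology[OF continuous_map_from_subtopology[OF continuous_q]])
        (auto simp: N_def)
    moreover have "continuous_map (subtopology (unit_space H) (grange H ` B)) (gtop H) s"
      using s unfolding homeomorphic_maps_def continuous_map_in_subtopology by blast
    ultimately have "continuous_map (subtopology Z N) (gtop H) (s \<circ> q)"
      by (rule continuous_map_compose)
    then have "continuous_map (subtopology Z N) (prod_topology Z (gtop H)) (\<lambda>w. (w, (s \<circ> q) w))"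
      by (intro continuous_map_pairedI continuous_map_from_subtopology[OF continuous_map_id, unfolded id_def])
    moreover have "(w, (s \<circ> q) w) \<in> right_dom H Z q" if w: "w \<in> N" for w
    proof -
      obtain b where "b \<in> B" "q w = grange H b" "w \<in> topspace Z" using w by (auto simp: N_def)
      then show ?thesis using BH by (auto simp: right_dom_def arrows_def sr)
    qed
    ultimately have "continuous_map (subtopology Z N) (right_dom_topology H Z q) (\<lambda>w. (w, (s \<circ> q) w))"
      unfolding right_dom_topology_def using NZ by (intro continuous_map_into_subtopology) auto
    from continuous_map_compose[OF this continuous_act]
    have "continuous_map (subtopology Z N) Z (\<lambda>w. r w (s (q w)))" by (simp add: comp_def)
    from openin_continuous_map_preimage[OF this U]
    have M: "openin Z {w \<in> N. r w (s (q w)) \<in> U}"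
      unfolding NZ using openin_trans_full[OF _ N] by blast
    have "{w \<in> N. r w (s (q w)) \<in> U} \<subseteq> {z \<in> topspace Z. p z \<in> p ` U}"
    proof clarify
      fix w assume w: "w \<in> N" "r w (s (q w)) \<in> U"
      then obtain b where "b \<in> B" "q w = grange H b" "w \<in> topspace Z" by (auto simp: N_def)
      then have "(w, s (q w)) \<in> right_dom H Z q" using BH by (auto simp: right_dom_def arrows_def sr)
      from p_act[OF this] show "w \<in> topspace Z \<and> p w \<in> p ` U"
        using imageI[OF w(2), of p] \<open>w \<in> topspace Z\<close> by simp
    qed
    moreover have "z \<in> {w \<in> N. r w (s (q w)) \<in> U}"
      using z B(2) in_domD(3)[OF h(1)] h(2) u(1) by (auto simp: N_def sr)
    ultimately show "\<exists>T. openin Z T \<and> z \<in> T \<and> T \<subseteq> {z \<in> topspace Z. p z \<in> p ` U}"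
      using M by blast
  qed
  moreover have "p ` U \<subseteq> topspace X" using surj_p UZ by blast
  ultimately show "openin X (p ` U)"
    using quotient_map_p unfolding quotient_map_def by blast
qed

section \<open>The shear map and division\<close>

definition shear :: "'z \<times> 'b \<Rightarrow> 'z \<times> 'z" where
  "shear = (\<lambda>(z, h). (r z h, z))"

lemma topspace_dom: "topspace (right_dom_topology H Z q) = right_dom H Z q"
  by (auto simp: right_dom_topology_def right_dom_def arrows_def)

lemma inj_shear: "inj_on shear (right_dom H Z q)"
  by (auto simp: inj_on_def shear_def intro: act_injective)

lemma shear_image: "shear ` right_dom H Z q = {(w, z). w \<in> topspace Z \<and> z \<in> topspace Z \<and> p w = p z}"
proof
  show "shear ` right_dom H Z q \<subseteq> {(w, z). w \<in> topspace Z \<and> z \<in> topspace Z \<and> p w = p z}"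
    by (auto simp: shear_def act_closed in_domD(1) p_act)
  show "{(w, z). w \<in> topspace Z \<and> z \<in> topspace Z \<and> p w = p z} \<subseteq> shear ` right_dom H Z q"
  proof clarify
    fix w z assume "w \<in> topspace Z" "z \<in> topspace Z" "p w = p z"
    then obtain h where "(z, h) \<in> right_dom H Z q" "r z h = w" by (metis same_orbit)
    then show "(w, z) \<in> shear ` right_dom H Z q" by (force simp: shear_def)
  qed
qed

lemma proper_shear: "proper_map (right_dom_topology H Z q) (prod_topology Z Z) shear"
  using proper by (simp add: proper_right_action_def shear_def)

text \<open>Freeness makes the shear injective and properness makes it closed. Together with
  \<open>shear_image\<close> this identifies the domain of the action with the fibre square of
  \<open>p\<close>.\<close>

lemma embedding_shear: "embedding_map (right_dom_topology H Z q) (prod_topology Z Z) shear"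
proof (rule injective_closed_imp_embedding_map)
  have "continuous_map (right_dom_topology H Z q) Z fst"
    unfolding right_dom_topology_def by (intro continuous_map_from_subtopology continuous_map_fst)
  with continuous_act
  show "continuous_map (right_dom_topology H Z q) (prod_topology Z Z) shear"
    by (simp add: shear_def case_prod_unfold continuous_map_paired)
qed (use proper_shear inj_shear in \<open>simp_all add: proper_map_def topspace_dom\<close>)

text \<open>Freeness and closedness of \<open>shear\<close> separate the diagonal from the pairs \<open>(r z h, z)\<close> with
  \<open>h\<close> not a unit.\<close>

lemma locally_injective_p:
  assumes z: "z \<in> topspace Z"
  obtains U where "openin Z U" "z \<in> U" "inj_on p U"
proof -
  let ?D = "right_dom H Z q"
  let ?N = "{w \<in> ?D. snd w \<in> units H}"
  have "continuous_map (right_dom_topology H Z q) (gtop H) snd"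
    unfolding right_dom_topology_def by (intro continuous_map_from_subtopology continuous_map_snd)
  from openin_continuous_map_preimage[OF this openin_units]
  have "openin (right_dom_topology H Z q) ?N" by (simp add: topspace_dom)
  then have "closedin (right_dom_topology H Z q) (?D - ?N)"
    using closedin_diff[OF closedin_topspace] topspace_dom by metis
  then have cl: "closedin (prod_topology Z Z) (shear ` (?D - ?N))"
    using proper_shear unfolding proper_map_def closed_map_def by blast
  have "(z, z) \<notin> shear ` (?D - ?N)"
    using free unfolding free_right_action_def by (auto simp: shear_def)
  then have "(z, z) \<in> topspace (prod_topology Z Z) - shear ` (?D - ?N)" using z by simp
  moreover have "openin (prod_topology Z Z) (topspace (prod_topology Z Z) - shear ` (?D - ?N))"
    using cl by blast
  ultimately obtain A B where AB: "openin Z A" "openin Z B" "z \<in> A" "z \<in> B"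
    "A \<times> B \<subseteq> topspace (prod_topology Z Z) - shear ` (?D - ?N)"
    unfolding openin_prod_topology_alt by meson
  have "inj_on p (A \<inter> B)"
  proof (rule inj_onI)
    fix u w assume uw: "u \<in> A \<inter> B" "w \<in> A \<inter> B" "p u = p w"
    then have "u \<in> topspace Z" "w \<in> topspace Z" using openin_subset[OF AB(1)] by auto
    then obtain h where h: "(u, h) \<in> ?D" "r u h = w" using same_orbit uw(3) by metis
    have "(w, u) \<notin> shear ` (?D - ?N)" using AB(5) uw by blast
    moreover have "(w, u) = shear (u, h)" by (simp add: shear_def h(2))
    ultimately have "h \<in> units H" using h(1) by auto
    then have "h = q u" using in_domD(3)[OF h(1)] units_iff by simp
    then show "u = w" using h(2) act_unit[OF in_domD(1)[OF h(1)]] by simp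
  qed
  then show ?thesis using AB that[of "A \<inter> B"] by blast
qed

text \<open>The translation function of the principal bundle, meaningful when
  \<open>p w = p z\<close>: the unique arrow that carries \<open>z\<close> to
  \<open>w\<close>.\<close>

definition quo :: "'z \<Rightarrow> 'z \<Rightarrow> 'b" where
  "quo w z = (THE h. (z, h) \<in> right_dom H Z q \<and> r z h = w)"

lemma quo_act: "(z, h) \<in> right_dom H Z q \<Longrightarrow> quo (r z h) z = h"
  unfolding quo_def by (rule the_equality) (auto intro: act_injective)

text \<open>Division is the arrow coordinate of the inverse of the shear, which is continuous
  because the shear is an embedding.\<close>

lemma continuous_quo:
  "continuous_map (subtopology (prod_topology Z Z) {(w, z). p w = p z}) (gtop H) (\<lambda>(w, z). quo w z)"
proof -
  let ?E = "subtopology (prod_topology Z Z) (shear ` right_dom H Z q)"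
  have "homeomorphic_map (right_dom_topology H Z q) ?E shear"
    using embedding_shear by (simp add: embedding_map_def topspace_dom)
  then obtain e where e: "homeomorphic_maps (right_dom_topology H Z q) ?E shear e"
    unfolding homeomorphic_map_maps by (elim exE)
  have "continuous_map (right_dom_topology H Z q) (gtop H) snd"
    unfolding right_dom_topology_def by (intro continuous_map_from_subtopology continuous_map_snd)
  moreover have "continuous_map ?E (right_dom_topology H Z q) e"
    using e by (simp add: homeomorphic_maps_def)
  ultimately have "continuous_map ?E (gtop H) (snd \<circ> e)"
    by (metis continuous_map_compose)
  then have "continuous_map ?E (gtop H) (\<lambda>(w, z). quo w z)"
  proof (rule continuous_map_eq)
    fix x assume "x \<in> topspace ?E"
    then obtain z h where zh: "(z, h) \<in> right_dom H Z q" "x = shear (z, h)" by auto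
    then have "e x = (z, h)" using e by (simp add: homeomorphic_maps_def topspace_dom)
    then show "(snd \<circ> e) x = (case x of (w, z) \<Rightarrow> quo w z)"
      using zh by (simp add: shear_def quo_act)
  qed
  moreover have "?E = subtopology (prod_topology Z Z) {(w, z). p w = p z}"
    unfolding shear_image
    by (subst (2) subtopology_restrict[symmetric], rule arg_cong[of _ _ "subtopology _"]) auto
  ultimately show ?thesis by simp
qed

end


section \<open>From an equivalence to an isomorphism of stabilizations\<close>

lemma open_map_prod:
  assumes "open_map X X' f" "open_map Y Y' g"
  shows "open_map (prod_topology X Y) (prod_topology X' Y') (map_prod f g)"
  unfolding open_map_def
proof (intro allI impI)
  fix V assume V: "openin (prod_topology X Y) V"
  show "openin (prod_topology X' Y') (map_prod f g ` V)"
    unfolding openin_prod_topology_alt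
  proof (intro allI impI)
    fix a b assume "(a, b) \<in> map_prod f g ` V"
    then obtain x y where xy: "(x, y) \<in> V" "a = f x" "b = g y" by auto
    then obtain A B where AB: "openin X A" "openin Y B" "x \<in> A" "y \<in> B" "A \<times> B \<subseteq> V"
      using V unfolding openin_prod_topology_alt by meson
    then have "openin X' (f ` A)" "openin Y' (g ` B)" using assms by (simp_all add: open_map_def)
    moreover have "f ` A \<times> g ` B \<subseteq> map_prod f g ` V"
      using image_mono[OF AB(5), of "map_prod f g"] by (auto simp: map_prod_surj_on)
    ultimately show "\<exists>U V'. openin X' U \<and> openin Y' V' \<and> a \<in> U \<and> b \<in> V' \<and> U \<times> V' \<subseteq> map_prod f g ` V"
      using AB xy by blast
  qed
qed

text \<open>The projection \<open>(z, i, j) -> (p z, i)\<close> restricted to \<open>W\<close> is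
  continuous, open and bijective, so it has a continuous inverse. Its coordinates
  \<open>\<sigma>\<close> and \<open>\<tau>\<close> select the matched point in the fibre and the
  level on the other side.\<close>

lemma matching_section:
  assumes W: "is_matching Z X Y p q W" and p: "continuous_map Z X p" "open_map Z X p"
  obtains \<sigma> \<tau> where
    "continuous_map (prod_topology X (discrete_topology UNIV)) Z (\<lambda>(x, i). \<sigma> x i)"
    "continuous_map (prod_topology X (discrete_topology UNIV)) (discrete_topology UNIV) (\<lambda>(x, i). \<tau> x i)"
    "\<And>x i z j. x \<in> topspace X \<Longrightarrow> (z, i, j) \<in> W \<and> p z = x \<longleftrightarrow> z = \<sigma> x i \<and> j = \<tau> x i"
proof -
  let ?P = "prod_topology Z (discrete_topology UNIV)" and ?Q = "prod_topology X (discrete_topology (UNIV :: nat set))"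
  let ?f = "map_prod p fst :: 'a \<times> nat \<times> nat \<Rightarrow> _"
  have oW: "openin ?P W" using W by (simp add: is_matching_def)
  have WP: "W \<subseteq> topspace ?P" by (rule openin_subset[OF oW])
  have tW: "topspace (subtopology ?P W) = W" using WP by auto
  have ex1: "\<exists>!(z, j). (z, i, j) \<in> W \<and> p z = x" if "x \<in> topspace X" for x i
    using W that by (simp add: is_matching_def)
  have pz: "p z \<in> topspace X" if "(z, i, j) \<in> W" for z i j
    using that WP continuous_map_image_subset_topspace[OF p(1)] by auto
  have uniq: "z = z' \<and> j = j'" if "(z, i, j) \<in> W" "(z', i, j') \<in> W" "p z = p z'" for z z' i j j'
    using ex1[OF pz[OF that(1)], of i] that by auto
  have "homeomorphic_map (subtopology ?P W) ?Q ?f"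
  proof (rule bijective_open_imp_homeomorphic_map)
    have "continuous_map ?P ?Q ?f"
      using p(1) by (auto simp: map_prod_def continuous_map_prod_top)
    then show "continuous_map (subtopology ?P W) ?Q ?f" by (rule continuous_map_from_subtopology)
    have "open_map ?P ?Q ?f" by (rule open_map_prod[OF p(2)]) (simp add: open_map_def)
    then show "open_map (subtopology ?P W) ?Q ?f" by (rule open_map_from_subtopology[OF _ oW])
    show "?f ` topspace (subtopology ?P W) = topspace ?Q"
    proof
      show "?f ` topspace (subtopology ?P W) \<subseteq> topspace ?Q" unfolding tW using pz by auto
      show "topspace ?Q \<subseteq> ?f ` topspace (subtopology ?P W)"
      proof clarify
        fix x i assume "(x, i) \<in> topspace ?Q"
        then obtain z j where "(z, i, j) \<in> W" "p z = x" using ex1[of x i] by auto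
        then show "(x, i) \<in> ?f ` topspace (subtopology ?P W)" unfolding tW by force
      qed
    qed
    show "inj_on ?f (topspace (subtopology ?P W))"
      unfolding tW using uniq by (fastforce intro: inj_onI)
  qed
  then obtain s where s: "homeomorphic_maps (subtopology ?P W) ?Q ?f s"
    unfolding homeomorphic_map_maps by (elim exE)
  have c: "continuous_map ?Q ?P s" and sW: "s ` topspace ?Q \<subseteq> W"
    using s unfolding homeomorphic_maps_def continuous_map_in_subtopology by auto
  have inv: "?f (s (x, i)) = (x, i)" if "x \<in> topspace X" for x i
    using s that unfolding homeomorphic_maps_def by simp
  define \<sigma> where "\<sigma> x i = fst (s (x, i))" for x i
  define \<tau> where "\<tau> x i = snd (snd (s (x, i)))" for x i
  have "continuous_map ?Q Z (fst \<circ> s)" by (rule continuous_map_compose[OF c continuous_map_fst])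
  then have 1: "continuous_map ?Q Z (\<lambda>(x, i). \<sigma> x i)" by (simp add: \<sigma>_def comp_def case_prod_unfold)
  have "continuous_map ?Q (discrete_topology UNIV) (snd \<circ> (snd \<circ> s))"
    by (rule continuous_map_compose[OF continuous_map_compose[OF c continuous_map_snd]]) simp
  then have 2: "continuous_map ?Q (discrete_topology UNIV) (\<lambda>(x, i). \<tau> x i)"
    by (simp add: \<tau>_def comp_def case_prod_unfold)
  have 3: "(z, i, j) \<in> W \<and> p z = x \<longleftrightarrow> z = \<sigma> x i \<and> j = \<tau> x i" if x: "x \<in> topspace X" for x i z j
  proof -
    have "s (x, i) = (\<sigma> x i, i, \<tau> x i)" "p (\<sigma> x i) = x"
      using inv[OF x, of i] by (auto simp: \<sigma>_def \<tau>_def prod_eq_iff)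
    moreover have "s (x, i) \<in> W" using sW x by auto
    ultimately show ?thesis using uniq by metis
  qed
  show ?thesis using 1 2 3 by (rule that)
qed

text \<open>A relation instead of a function, because the condition \<open>v h = g w\<close> treats
  \<open>G\<close> and \<open>H\<close> alike. One proof that it is the graph of a continuous map
  then serves, after reversal, for the inverse map as well.\<close>

definition arrow_matching ::
    "'a top_groupoid \<Rightarrow> 'b top_groupoid \<Rightarrow> ('z \<Rightarrow> 'a) \<Rightarrow> ('z \<Rightarrow> 'b) \<Rightarrow> ('a \<Rightarrow> 'z \<Rightarrow> 'z) \<Rightarrow>
     ('z \<Rightarrow> 'b \<Rightarrow> 'z) \<Rightarrow> ('z \<times> nat \<times> nat) set \<Rightarrow> 'a \<times> nat \<times> nat \<Rightarrow> 'b \<times> nat \<times> nat \<Rightarrow> bool" where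
  "arrow_matching G H p q l r W = (\<lambda>(g, i, j) (h, i', j').
     g \<in> arrows G \<and> h \<in> arrows H \<and>
     (\<exists>v w. (v, i, i') \<in> W \<and> (w, j, j') \<in> W \<and> p v = grange G g \<and> p w = gsource G g \<and>
        q v = grange H h \<and> q w = gsource H h \<and> r v h = l g w))"

text \<open>Reversal exchanges the roles of \<open>v\<close> and \<open>w\<close>. The two levels of
  each arrow change places too, because the level of the source becomes that of the range.\<close>

lemma arrow_matching_opposite:
  "arrow_matching (opposite H) (opposite G) q p (\<lambda>h z. r z h) (\<lambda>z g. l g z) {(z, j, i). (z, i, j) \<in> W}
     (h, j', i') (g, j, i) \<longleftrightarrow> arrow_matching G H p q l r W (g, i, j) (h, i', j')"
  by (simp add: arrow_matching_def) metis

locale ample_equivalence = G: ample_groupoid G + H: ample_groupoid H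
  for G :: "'a top_groupoid" and H :: "'b top_groupoid" +
  fixes Z :: "'z topology" and p q l r
  assumes equivalence: "groupoid_equivalence G H Z p q l r"
begin

lemma ample_equivalence_opposite:
  "ample_equivalence (opposite H) (opposite G) Z q p (\<lambda>h z. r z h) (\<lambda>z g. l g z)"
proof -
  interpret G': ample_groupoid "opposite G" by (rule G.ample_groupoid_opposite)
  interpret H': ample_groupoid "opposite H" by (rule H.ample_groupoid_opposite)
  show ?thesis
    by unfold_locales
      (rule groupoid_equivalence_opposite[OF G.groupoid_axioms H.groupoid_axioms equivalence])
qed

sublocale R: principal_right H Z q r "unit_space G" p
  using equivalence by unfold_locales (simp_all add: groupoid_equivalence_def)

sublocale L: principal_right "opposite G" Z p "\<lambda>z g. l g z" "unit_space H" q
proof -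
  interpret op: ample_equivalence "opposite H" "opposite G" Z q p "\<lambda>h z. r z h" "\<lambda>z g. l g z"
    by (rule ample_equivalence_opposite)
  show "principal_right (opposite G) Z p (\<lambda>z g. l g z) (unit_space H) q"
    using op.R.principal_right_axioms by simp
qed

lemma commute:
  "\<lbrakk>(g, z) \<in> left_dom G Z p; (z, h) \<in> right_dom H Z q\<rbrakk> \<Longrightarrow> r (l g z) h = l g (r z h)"
  using equivalence unfolding groupoid_equivalence_def by blast

text \<open>The right-hand side is forced: \<open>v\<close> and \<open>w\<close> are the points of
  \<open>W\<close> over the range and source of \<open>g\<close> at levels \<open>i\<close> and
  \<open>j\<close>, and \<open>h\<close> is the quotient of \<open>l g w\<close> by
  \<open>v\<close>, which exists because both lie over \<open>grange G g\<close>. Continuity comes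
  from that of the section of \<open>W\<close> and of division.\<close>

lemma arrow_matching_map:
  assumes W: "is_matching Z (unit_space G) (unit_space H) p q W"
  obtains F where
    "continuous_map (prod_topology (gtop G) (discrete_topology UNIV))
       (prod_topology (gtop H) (discrete_topology UNIV)) F"
    "\<And>g i j k. g \<in> arrows G \<Longrightarrow> arrow_matching G H p q l r W (g, i, j) k \<longleftrightarrow> k = F (g, i, j)"
proof -
  let ?D = "discrete_topology (UNIV :: nat set)" and ?D2 = "discrete_topology (UNIV :: (nat \<times> nat) set)"
  let ?T = "prod_topology (gtop G) ?D2"
  obtain \<sigma> \<tau> where c\<sigma>: "continuous_map (prod_topology (unit_space G) ?D) Z (\<lambda>(x, i). \<sigma> x i)"
    and c\<tau>: "continuous_map (prod_topology (unit_space G) ?D) ?D (\<lambda>(x, i). \<tau> x i)"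
    and st: "\<And>x i z j. x \<in> topspace (unit_space G) \<Longrightarrow>
      (z, i, j) \<in> W \<and> p z = x \<longleftrightarrow> z = \<sigma> x i \<and> j = \<tau> x i"
    by (rule matching_section[OF W R.continuous_p R.open_p]) blast
  have p\<sigma>: "p (\<sigma> x i) = x" and \<sigma>W: "(\<sigma> x i, i, \<tau> x i) \<in> W" if "x \<in> units G" for x i
    using st[of x "\<sigma> x i" i "\<tau> x i"] that by (simp_all add: G.topspace_unit_space)
  have \<sigma>Z: "\<sigma> x i \<in> topspace Z" if "x \<in> units G" for x i
    using continuous_map_image_subset_topspace[OF c\<sigma>] that by (force simp: G.topspace_unit_space)
  let ?v = "\<lambda>(g, i, j). \<sigma> (grange G g) i" and ?w = "\<lambda>(g, i, j). \<sigma> (gsource G g) j"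
  let ?F = "\<lambda>(g, i, j). (R.quo (l g (\<sigma> (gsource G g) j)) (\<sigma> (grange G g) i),
      \<tau> (grange G g) i, \<tau> (gsource G g) j)"
  have "continuous_map ?T ?D (fst \<circ> snd)" "continuous_map ?T ?D (snd \<circ> snd)"
    by (rule continuous_map_compose[OF continuous_map_snd], simp)+
  moreover have "continuous_map ?T (unit_space G) (grange G \<circ> fst)" "continuous_map ?T (unit_space G) (gsource G \<circ> fst)"
    by (rule continuous_map_compose[OF continuous_map_fst G.continuous_range]
        continuous_map_compose[OF continuous_map_fst G.continuous_source])+
  ultimately have rs: "continuous_map ?T (prod_topology (unit_space G) ?D) (\<lambda>x. ((grange G \<circ> fst) x, (fst \<circ> snd) x))"
    "continuous_map ?T (prod_topology (unit_space G) ?D) (\<lambda>x. ((gsource G \<circ> fst) x, (snd \<circ> snd) x))"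
    by (simp_all only: continuous_map_paired simp_thms)
  have cv: "continuous_map ?T Z ?v" and cw: "continuous_map ?T Z ?w"
    using continuous_map_compose[OF rs(1) c\<sigma>] continuous_map_compose[OF rs(2) c\<sigma>]
    by (simp_all add: comp_def case_prod_unfold)
  have ctau: "continuous_map ?T ?D (\<lambda>(g, i, j). \<tau> (grange G g) i)" "continuous_map ?T ?D (\<lambda>(g, i, j). \<tau> (gsource G g) j)"
    using continuous_map_compose[OF rs(1) c\<tau>] continuous_map_compose[OF rs(2) c\<tau>]
    by (simp_all add: comp_def case_prod_unfold)
  have dom: "(\<sigma> (gsource G g) j, g) \<in> right_dom (opposite G) Z p" if "g \<in> arrows G" for g j
    using that by (auto simp: right_dom_def p\<sigma> \<sigma>Z G.source_unit)
  have "continuous_map ?T (right_dom_topology (opposite G) Z p) (\<lambda>x. (?w x, fst x))"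
    unfolding right_dom_topology_def
    by (intro continuous_map_into_subtopology continuous_map_pairedI cw)
      (auto simp: continuous_map_fst arrows_def[symmetric] right_dom_def p\<sigma> \<sigma>Z G.source_unit)
  from continuous_map_compose[OF this L.continuous_act]
  have "continuous_map ?T Z (\<lambda>x. l (fst x) (?w x))" by (simp add: comp_def)
  then have "continuous_map ?T (subtopology (prod_topology Z Z) {(w, z). p w = p z})
      (\<lambda>x. (l (fst x) (?w x), ?v x))"
    by (intro continuous_map_into_subtopology continuous_map_pairedI cv)
      (auto simp: arrows_def[symmetric] p\<sigma> G.range_unit L.anchor_act[OF dom, simplified])
  from continuous_map_compose[OF this R.continuous_quo]
  have cq: "continuous_map ?T (gtop H) (\<lambda>x. R.quo (l (fst x) (?w x)) (?v x))" by (simp add: comp_def)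
  have F: "continuous_map ?T (prod_topology (gtop H) ?D2) ?F"
    using continuous_map_pairedI[OF cq continuous_map_pairedI[OF ctau]]
    by (simp add: prod_topology_discrete_topology[symmetric] case_prod_unfold)
  have "arrow_matching G H p q l r W (g, i, j) k \<longleftrightarrow> k = ?F (g, i, j)" if g: "g \<in> arrows G" for g i j k
  proof -
    let ?V = "\<sigma> (grange G g) i" and ?U = "\<sigma> (gsource G g) j"
    note ru = G.range_unit[OF g] and su = G.source_unit[OF g]
    have "p ?V = p (l g ?U)" using L.anchor_act[OF dom[OF g]] by (simp add: p\<sigma> ru)
    then obtain h where h: "(?V, h) \<in> right_dom H Z q" "r ?V h = l g ?U"
      using R.same_orbit[OF \<sigma>Z[OF ru] L.act_closed[OF dom[OF g]]] by blast
    have Fh: "?F (g, i, j) = (h, \<tau> (grange G g) i, \<tau> (gsource G g) j)"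
      using R.quo_act[OF h(1)] by (simp add: h(2))
    \<comment> \<open>Both sides equal \<open>q\<close> of the common point \<open>l g ?U\<close>,
      since \<open>q\<close> is constant on orbits of the left action.\<close>
    have "q ?U = gsource H h"
      using R.anchor_act[OF h(1)] L.p_act[OF dom[OF g]] by (simp add: h(2))
    then have "\<exists>v w. (v, i, \<tau> (grange G g) i) \<in> W \<and> (w, j, \<tau> (gsource G g) j) \<in> W \<and>
        p v = grange G g \<and> p w = gsource G g \<and> q v = grange H h \<and> q w = gsource H h \<and> r v h = l g w"
      using R.in_domD(3)[OF h(1)] h(2) \<sigma>W[OF ru] \<sigma>W[OF su] p\<sigma>[OF ru] p\<sigma>[OF su]
      by - (rule exI[of _ ?V], rule exI[of _ ?U], simp)
    then have "arrow_matching G H p q l r W (g, i, j) (?F (g, i, j))"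
      using g R.in_domD(2)[OF h(1)] unfolding Fh arrow_matching_def by simp
    moreover have "k = ?F (g, i, j)" if k: "arrow_matching G H p q l r W (g, i, j) k"
    proof -
      obtain h' i' j' where k': "k = (h', i', j')" by (metis surj_pair)
      obtain v w where vw: "(v, i, i') \<in> W" "(w, j, j') \<in> W" "p v = grange G g" "p w = gsource G g"
        "q v = grange H h'" "r v h' = l g w" "h' \<in> arrows H"
        using k unfolding k' arrow_matching_def by auto
      have "v = ?V \<and> i' = \<tau> (grange G g) i" "w = ?U \<and> j' = \<tau> (gsource G g) j"
        using st[of "grange G g" v i i'] st[of "gsource G g" w j j'] vw ru su
        by (simp_all add: G.topspace_unit_space)
      moreover from this vw have "h' = h"
        by (intro R.act_injective[OF _ h(1)]) (simp_all add: right_dom_def \<sigma>Z[OF ru] h(2))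
      ultimately show ?thesis unfolding k' Fh by simp
    qed
    ultimately show ?thesis by blast
  qed
  with F show ?thesis by (rule that)
qed

theorem stable_isomorphism_if_matching:
  assumes W: "is_matching Z (unit_space G) (unit_space H) p q W"
  shows "groupoid_isomorphic (prod_groupoid G full_relation) (prod_groupoid H full_relation)"
proof -
  interpret op: ample_equivalence "opposite H" "opposite G" Z q p "\<lambda>h z. r z h" "\<lambda>z g. l g z"
    by (rule ample_equivalence_opposite)
  let ?D2 = "discrete_topology (UNIV :: (nat \<times> nat) set)"
  let ?m = "arrow_matching G H p q l r W"
  obtain F where cF: "continuous_map (prod_topology (gtop G) ?D2) (prod_topology (gtop H) ?D2) F"
    and F: "\<And>g i j k. g \<in> arrows G \<Longrightarrow> ?m (g, i, j) k \<longleftrightarrow> k = F (g, i, j)"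
    by (rule arrow_matching_map[OF W]) blast
  \<comment> \<open>The opposite equivalence with the flipped matching yields the inverse, up to the
    order of the levels.\<close>
  obtain F' where cF': "continuous_map (prod_topology (gtop H) ?D2) (prod_topology (gtop G) ?D2) F'"
    and F': "\<And>h j' i' g j i. h \<in> arrows H \<Longrightarrow> ?m (g, i, j) (h, i', j') \<longleftrightarrow> (g, j, i) = F' (h, j', i')"
  proof (rule op.arrow_matching_map)
    show "is_matching Z (unit_space (opposite H)) (unit_space (opposite G)) q p {(z, j, i). (z, i, j) \<in> W}"
      using is_matching_flip[OF W] by simp
  qed (auto simp: arrow_matching_opposite)
  \<comment> \<open>Restores the order of the two levels that reversal has exchanged.\<close>
  let ?s = "\<lambda>(g, i, j). (g, j, i)"
  have cs: "continuous_map (prod_topology T ?D2) (prod_topology T ?D2) ?s" for T :: "'t topology"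
  proof -
    have "continuous_map (prod_topology T ?D2) (prod_topology T ?D2) (\<lambda>(g, k). (g, prod.swap k))"
      by (simp add: continuous_map_prod_top continuous_map_id[unfolded id_def])
    then show ?thesis by (simp add: case_prod_unfold prod.swap_def)
  qed
  have m_arrows: "fst a \<in> arrows G" "fst b \<in> arrows H" if "?m a b" for a b
    using that by (auto simp: arrow_matching_def)
  have FD: "?m a (F a)" if "fst a \<in> arrows G" for a using F that by (cases a) auto
  have F'D: "?m (?s (F' (?s b))) b" if "fst b \<in> arrows H" for b
    using F' that by (cases b; cases "F' (?s b)") auto
  have "homeomorphic_maps (prod_topology (gtop G) ?D2) (prod_topology (gtop H) ?D2) F (?s \<circ> (F' \<circ> ?s))"
    unfolding homeomorphic_maps_def
  proof (intro conjI ballI)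
    show "continuous_map (prod_topology (gtop H) ?D2) (prod_topology (gtop G) ?D2) (?s \<circ> (F' \<circ> ?s))"
      by (intro continuous_map_compose[OF _ cs] continuous_map_compose[OF cs] cF')
    fix a assume "a \<in> topspace (prod_topology (gtop G) ?D2)"
    then have m: "?m a (F a)" by (intro FD) (auto simp: arrows_def)
    obtain g i j h i' j' where ab: "a = (g, i, j)" "F a = (h, i', j')" by (metis surj_pair)
    then have "F' (h, j', i') = (g, j, i)" using m F' m_arrows(2)[OF m] by simp
    then show "(?s \<circ> (F' \<circ> ?s)) (F a) = a" unfolding ab(2) by (simp add: ab(1))
  next
    fix b assume "b \<in> topspace (prod_topology (gtop H) ?D2)"
    then have m: "?m (?s (F' (?s b))) b" by (intro F'D) (auto simp: arrows_def)
    then show "F ((?s \<circ> (F' \<circ> ?s)) b) = b"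
      using F m_arrows(1)[OF m] by (cases "F' (?s b)") simp
  qed (rule cF)
  then have hF: "homeomorphic_map (prod_topology (gtop G) ?D2) (prod_topology (gtop H) ?D2) F"
    by (rule homeomorphic_maps_imp_map)
  have units: "F (grange G g, i, i) = (grange H (fst (F (g, i, j))), fst (snd (F (g, i, j))), fst (snd (F (g, i, j)))) \<and>
      F (gsource G g, j, j) = (gsource H (fst (F (g, i, j))), snd (snd (F (g, i, j))), snd (snd (F (g, i, j))))"
    if g: "g \<in> arrows G" for g i j
  proof -
    obtain h i' j' where h: "F (g, i, j) = (h, i', j')" by (metis surj_pair)
    then have "?m (g, i, j) (h, i', j')" using F[OF g] by simp
    then obtain v w where vw: "h \<in> arrows H" "(v, i, i') \<in> W" "(w, j, j') \<in> W" "p v = grange G g" "p w = gsource G g"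
      "q v = grange H h" "q w = gsource H h" "r v h = l g w"
      by (auto simp: arrow_matching_def)
    have "W \<subseteq> topspace Z \<times> UNIV"
      using W openin_subset unfolding is_matching_def by fastforce
    then have Z: "v \<in> topspace Z" "w \<in> topspace Z" using vw by auto
    \<comment> \<open>Units act trivially, so \<open>v\<close> taken for both witnesses matches the
      range units, and \<open>w\<close> taken twice matches the source units.\<close>
    have "r v (q v) = l (p v) v" "r w (q w) = l (p w) w"
      using Z by (simp_all add: R.act_unit L.act_unit)
    then have "?m (grange G g, i, i) (grange H h, i', i')" "?m (gsource G g, j, j) (gsource H h, j', j')"
      using vw g by (auto simp: arrow_matching_def G.range_closed G.source_closed H.range_closed H.source_closed
          G.range_range G.source_range G.range_source G.source_source
          H.range_range H.source_range H.range_source H.source_source)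
    then show ?thesis using F g by (simp add: h G.range_closed G.source_closed)
  qed
  have mult: "F (gmult G g g', i, k) = (gmult H (fst (F (g, i, j))) (fst (F (g', j, k))),
      fst (snd (F (g, i, j))), snd (snd (F (g', j, k))))"
    if c: "(g, g') \<in> composable G" for g g' i j k
  proof -
    have g: "g \<in> arrows G" "g' \<in> arrows G" "gsource G g = grange G g'" using c by (auto simp: composable_def)
    obtain h i' j' where h: "F (g, i, j) = (h, i', j')" by (metis surj_pair)
    then have "?m (g, i, j) (h, i', j')" using F[OF g(1)] by simp
    then obtain v w where vw: "h \<in> arrows H" "(v, i, i') \<in> W" "(w, j, j') \<in> W" "p v = grange G g" "p w = gsource G g"
      "q v = grange H h" "q w = gsource H h" "r v h = l g w"
      by (auto simp: arrow_matching_def)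
    obtain h' j'' k' where h': "F (g', j, k) = (h', j'', k')" by (metis surj_pair)
    then have "?m (g', j, k) (h', j'', k')" using F[OF g(2)] by simp
    then obtain w' x where wx: "h' \<in> arrows H" "(w', j, j'') \<in> W" "(x, k, k') \<in> W" "p w' = grange G g'" "p x = gsource G g'"
      "q w' = grange H h'" "q x = gsource H h'" "r w' h' = l g' x"
      by (auto simp: arrow_matching_def)
    \<comment> \<open>The end of \<open>g\<close> and the beginning of \<open>g'\<close> lie over
      the same unit at the same level \<open>j\<close>, so they use the same point of
      \<open>W\<close>. This makes the image arrows composable, in \<open>H\<close> as well as in
      their levels.\<close>
    have "\<exists>!(z, j'). (z, j, j') \<in> W \<and> p z = grange G g'"
      using W G.range_unit[OF g(2)] by (simp add: is_matching_def G.topspace_unit_space)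
    then have w': "w' = w" "j'' = j'" using vw wx g(3) by auto
    have "W \<subseteq> topspace Z \<times> UNIV"
      using W openin_subset unfolding is_matching_def by fastforce
    then have Z: "v \<in> topspace Z" "w \<in> topspace Z" "x \<in> topspace Z" using vw wx by auto
    have ch: "(h, h') \<in> composable H" using vw wx w' by (simp add: composable_def)
    have d: "(v, h) \<in> right_dom H Z q" "(w, h') \<in> right_dom H Z q"
      using Z vw wx w' by (simp_all add: right_dom_def)
    have d': "(x, g') \<in> right_dom (opposite G) Z p" "(w, g) \<in> right_dom (opposite G) Z p"
      using Z vw wx g by (simp_all add: right_dom_def del: right_dom_opposite)
    have "r v (gmult H h h') = r (l g w) h'"
      using R.act_mult[OF d(1) ch] vw by simp
    also have "\<dots> = l g (r w h')" using commute[OF _ d(2)] d'(2) by simp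
    also have "\<dots> = l g (l g' x)" using wx w' by simp
    also have "\<dots> = l (gmult G g g') x" using L.act_mult[OF d'(1), of g] c by simp
    finally have "?m (gmult G g g', i, k) (gmult H h h', i', k')"
      unfolding arrow_matching_def using vw wx
      by (auto simp: G.mult_closed[OF c] H.mult_closed[OF ch] G.range_mult[OF c] G.source_mult[OF c]
          H.range_mult[OF ch] H.source_mult[OF ch])
    then show ?thesis using F[OF G.mult_closed[OF c]] by (simp add: h h')
  qed
  have "groupoid_isomorphism (prod_groupoid G full_relation) (prod_groupoid H full_relation) F"
    unfolding groupoid_isomorphism_def
  proof (intro conjI ballI)
    show "homeomorphic_map (gtop (prod_groupoid G full_relation)) (gtop (prod_groupoid H full_relation)) F"
      using hF by (simp add: prod_groupoid_def full_relation_def)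
    fix a assume "a \<in> arrows (prod_groupoid G full_relation)"
    then obtain g i j where a: "a = (g, i, j)" "g \<in> arrows G"
      by (cases a) (auto simp: arrows_prod_groupoid)
    show "F (grange (prod_groupoid G full_relation) a) = grange (prod_groupoid H full_relation) (F a)"
      "F (gsource (prod_groupoid G full_relation) a) = gsource (prod_groupoid H full_relation) (F a)"
      using units[OF a(2), of i j]
      by (cases "F (g, i, j)"; simp add: a(1) prod_groupoid_def full_relation_def)+
  next
    fix b assume b: "b \<in> composable (prod_groupoid G full_relation)"
    obtain g i j g' j' k where gb: "b = ((g, i, j), (g', j', k))" by (metis surj_pair)
    then have c: "(g, g') \<in> composable G" and j: "j' = j"
      using b unfolding gb composable_prod_groupoid by (auto simp: composable_def full_relation_def)
    show "case b of (a, a') \<Rightarrow> F (gmult (prod_groupoid G full_relation) a a') =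
        gmult (prod_groupoid H full_relation) (F a) (F a')"
      using mult[OF c, of i k j]
      by (cases "F (g, i, j)"; cases "F (g', j, k)") (simp add: gb j prod_groupoid_def full_relation_def)
  qed
  then show ?thesis unfolding groupoid_isomorphic_def by blast
qed

theorem stable_isomorphism:
  assumes "sigma_compact_space (unit_space G)" "sigma_compact_space (unit_space H)"
  shows "groupoid_isomorphic (prod_groupoid G full_relation) (prod_groupoid H full_relation)"
proof -
  interpret bisection_span Z "unit_space G" "unit_space H" p q
  proof
    fix z assume z: "z \<in> topspace Z"
    obtain U where U: "openin Z U" "z \<in> U" "inj_on p U" by (rule R.locally_injective_p[OF z])
    obtain V where V: "openin Z V" "z \<in> V" "inj_on q V" by (rule L.locally_injective_p[OF z])
    show "\<exists>U. openin Z U \<and> z \<in> U \<and> inj_on p U \<and> inj_on q U"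
      using U V by (intro exI[of _ "U \<inter> V"]) (auto simp: inj_on_def)
  qed (fact R.continuous_p R.open_p R.surj_p L.continuous_p L.open_p L.surj_p
      G.Hausdorff_unit_space H.Hausdorff_unit_space
      G.compact_open_basis_unit_space H.compact_open_basis_unit_space assms)+
  obtain W where "is_matching Z (unit_space G) (unit_space H) p q W"
    using matching_exists by blast
  then show ?thesis by (rule stable_isomorphism_if_matching)
qed

end


section \<open>Corners and the equivalences between them\<close>

lemma proper_map_closed_embedding:
  assumes f: "homeomorphic_map X (subtopology Y D) f" and D: "closedin Y D"
  shows "proper_map X Y f"
proof (rule closed_injective_imp_proper_map)
  show "closed_map X Y f"
    using homeomorphic_imp_closed_map[OF f] closedin_trans_full[OF _ D] by (auto simp: closed_map_def)
  show "inj_on f (topspace X)" by (rule homeomorphic_imp_injective_map[OF f])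
qed

definition corner :: "'k top_groupoid \<Rightarrow> 'k set \<Rightarrow> 'k set \<Rightarrow> 'k set" where
  "corner K U V = {k \<in> arrows K. grange K k \<in> U \<and> gsource K k \<in> V}"

lemma corner_opposite [simp]: "corner (opposite K) U V = corner K V U"
  by (auto simp: corner_def)

text \<open>\<open>homeo\<close> identifies \<open>G\<close> with the reduction of \<open>K\<close>
  to an open set of units, and \<open>full\<close> says that this set meets every orbit of
  \<open>K\<close>.\<close>

locale corner_embedding = dom: ample_groupoid G + cod: ample_groupoid K
  for G :: "'a top_groupoid" and K :: "'k top_groupoid" +
  fixes \<phi> :: "'a \<Rightarrow> 'k"
  assumes homeo: "homeomorphic_map (gtop G)
      (subtopology (gtop K) (corner K (\<phi> ` units G) (\<phi> ` units G))) \<phi>"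
    and map_range: "g \<in> arrows G \<Longrightarrow> \<phi> (grange G g) = grange K (\<phi> g)"
    and map_source: "g \<in> arrows G \<Longrightarrow> \<phi> (gsource G g) = gsource K (\<phi> g)"
    and map_mult: "(g, h) \<in> composable G \<Longrightarrow> \<phi> (gmult G g h) = gmult K (\<phi> g) (\<phi> h)"
    and open_units: "openin (gtop K) (\<phi> ` units G)"
    and full: "x \<in> units K \<Longrightarrow> \<exists>k \<in> arrows K. grange K k \<in> \<phi> ` units G \<and> gsource K k = x"
begin

lemma corner_embedding_opposite: "corner_embedding (opposite G) (opposite K) \<phi>"
proof -
  interpret dom': ample_groupoid "opposite G" by (rule dom.ample_groupoid_opposite)
  interpret cod': ample_groupoid "opposite K" by (rule cod.ample_groupoid_opposite)
  show ?thesis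
  proof
    fix x assume "x \<in> units (opposite K)"
    then have "x \<in> units K" by simp
    from full[OF this] obtain k where "k \<in> arrows K" "grange K k \<in> \<phi> ` units G" "gsource K k = x"
      by (elim bexE conjE)
    \<comment> \<open>Reversal exchanges range and source of the connecting arrow, so its inverse is
      the one to use.\<close>
    then show "\<exists>k\<in>arrows (opposite K). grange (opposite K) k \<in> \<phi> ` units (opposite G) \<and> gsource (opposite K) k = x"
      by (intro bexI[of _ "ginv K k"]) (auto simp: cod.range_inv cod.source_inv cod.inv_closed)
  qed (use homeo map_range map_source map_mult open_units in simp_all)
qed

lemma image: "\<phi> ` arrows G = corner K (\<phi> ` units G) (\<phi> ` units G)"
  using homeomorphic_imp_surjective_map[OF homeo] by (auto simp: arrows_def corner_def)

lemma map_arrow: "g \<in> arrows G \<Longrightarrow> \<phi> g \<in> arrows K"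
  using image by (auto simp: corner_def)

lemma map_composable: "(g, h) \<in> composable G \<Longrightarrow> (\<phi> g, \<phi> h) \<in> composable K"
  by (auto simp: composable_def map_arrow simp flip: map_range map_source)

lemma inj: "inj_on \<phi> (arrows G)"
  using homeomorphic_imp_injective_map[OF homeo] by (simp add: arrows_def)

definition pull :: "'k \<Rightarrow> 'a" where
  "pull = inv_into (arrows G) \<phi>"

lemma pull_map: "g \<in> arrows G \<Longrightarrow> pull (\<phi> g) = g"
  using inj by (simp add: pull_def)

lemma map_pull: "k \<in> corner K (\<phi> ` units G) (\<phi> ` units G) \<Longrightarrow> \<phi> (pull k) = k"
  unfolding pull_def image[symmetric] by (rule f_inv_into_f)

lemma pull_arrow: "k \<in> corner K (\<phi> ` units G) (\<phi> ` units G) \<Longrightarrow> pull k \<in> arrows G"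
  unfolding pull_def image[symmetric] by (rule inv_into_into)

lemma unit_in_corner: "x \<in> \<phi> ` units G \<Longrightarrow> x \<in> corner K (\<phi> ` units G) (\<phi> ` units G)"
  unfolding image[symmetric] using dom.units_iff by blast

lemma map_unit: "x \<in> \<phi> ` units G \<Longrightarrow> x \<in> units K"
  by (auto simp: dom.units_iff cod.units_iff map_arrow simp flip: map_range)

lemma pull_unit: "x \<in> \<phi> ` units G \<Longrightarrow> pull x \<in> units G"
  by (auto simp: pull_map dom.units_iff)

lemma continuous_embedding: "continuous_map (gtop G) (gtop K) \<phi>"
  using homeomorphic_imp_continuous_map[OF homeo] by (simp add: continuous_map_in_subtopology)

lemma continuous_pull:
  "continuous_map (subtopology (gtop K) (corner K (\<phi> ` units G) (\<phi> ` units G))) (gtop G) pull"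
proof -
  obtain e where e: "homeomorphic_maps (gtop G)
      (subtopology (gtop K) (corner K (\<phi> ` units G) (\<phi> ` units G))) \<phi> e"
    using homeo unfolding homeomorphic_map_maps by (elim exE)
  have "continuous_map (subtopology (gtop K) (corner K (\<phi> ` units G) (\<phi> ` units G))) (gtop G) e"
    using e by (simp add: homeomorphic_maps_def)
  then show ?thesis
  proof (rule continuous_map_eq)
    fix k assume "k \<in> topspace (subtopology (gtop K) (corner K (\<phi> ` units G) (\<phi> ` units G)))"
    then have k: "k \<in> corner K (\<phi> ` units G) (\<phi> ` units G)" by simp
    then have "e (\<phi> (pull k)) = pull k"
      using e pull_arrow by (simp add: homeomorphic_maps_def arrows_def)
    then show "e k = pull k" by (simp add: map_pull k)
  qed
qed

lemma corner_embedding_isomorphism: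
  assumes "ample_groupoid K'" and f: "groupoid_isomorphism K K' f"
  shows "corner_embedding G K' (f \<circ> \<phi>)"
proof -
  interpret K': ample_groupoid K' by fact
  have h: "homeomorphic_map (gtop K) (gtop K') f"
    using f by (simp add: groupoid_isomorphism_def)
  have rs: "f (grange K k) = grange K' (f k)" "f (gsource K k) = gsource K' (f k)" if "k \<in> arrows K" for k
    using f that by (simp_all add: groupoid_isomorphism_def)
  have m: "f (gmult K k l) = gmult K' (f k) (f l)" if "(k, l) \<in> composable K" for k l
    using f that by (auto simp: groupoid_isomorphism_def)
  have fi: "inj_on f (arrows K)" and fs: "f ` arrows K = arrows K'"
    using homeomorphic_imp_injective_map[OF h] homeomorphic_imp_surjective_map[OF h]
    by (simp_all add: arrows_def)
  have mem: "f x \<in> (f \<circ> \<phi>) ` units G \<longleftrightarrow> x \<in> \<phi> ` units G" if "x \<in> arrows K" for x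
  proof -
    have "\<phi> ` units G \<subseteq> arrows K" using map_unit cod.units_iff by blast
    from inj_on_image_mem_iff[OF fi that this] show ?thesis by (simp add: image_comp)
  qed
  have crn: "f k \<in> corner K' ((f \<circ> \<phi>) ` units G) ((f \<circ> \<phi>) ` units G) \<longleftrightarrow>
      k \<in> corner K (\<phi> ` units G) (\<phi> ` units G)" if k: "k \<in> arrows K" for k
    using k fs mem[OF cod.range_closed[OF k]] mem[OF cod.source_closed[OF k]]
    by (auto simp: corner_def rs simp del: o_apply image_comp)
  show ?thesis
  proof
    have "homeomorphic_map (subtopology (gtop K) (corner K (\<phi> ` units G) (\<phi> ` units G)))
        (subtopology (gtop K') (corner K' ((f \<circ> \<phi>) ` units G) ((f \<circ> \<phi>) ` units G))) f"
      by (rule homeomorphic_map_subtopologies_alt[OF h]) (simp only: crn arrows_def)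
    with homeo show "homeomorphic_map (gtop G)
        (subtopology (gtop K') (corner K' ((f \<circ> \<phi>) ` units G) ((f \<circ> \<phi>) ` units G))) (f \<circ> \<phi>)"
      by (rule homeomorphic_map_compose)
    show "openin (gtop K') ((f \<circ> \<phi>) ` units G)"
      using homeomorphic_imp_open_map[OF h] open_units unfolding open_map_def image_comp[symmetric] by blast
    fix x assume x: "x \<in> units K'"
    then have "x \<in> f ` arrows K" using fs K'.units_iff by simp
    then obtain y where y: "y \<in> arrows K" "f y = x" by auto
    \<comment> \<open>An isomorphism reflects units: \<open>f\<close> is injective and sends
      \<open>y\<close> and its range to the same unit.\<close>
    then have "grange K y = y"
      using x fi rs(1)[OF y(1)] K'.units_iff cod.range_closed[OF y(1)] by (auto dest: inj_onD)
    then have "y \<in> units K" using y by (simp add: cod.units_iff)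
    then obtain k where k: "k \<in> arrows K" "grange K k \<in> \<phi> ` units G" "gsource K k = y"
      using full[OF \<open>y \<in> units K\<close>] by (elim bexE conjE)
    then show "\<exists>k\<in>arrows K'. grange K' k \<in> (f \<circ> \<phi>) ` units G \<and> gsource K' k = x"
      using fs y(2) mem[OF cod.range_closed[OF k(1)]]
      by (intro bexI[of _ "f k"] conjI) (auto simp: rs(2) simp flip: rs(1) simp del: o_apply)
  qed (simp_all add: rs map_range map_source map_mult map_arrow m map_composable)
qed

end

text \<open>\<open>K\<close> plays the part of a linking groupoid, but its two corners may overlap.
  The space \<open>Z\<close> consists of the arrows from the second corner to the first, and
  \<open>pull\<close> turns their ends back into units of \<open>G\<close> and
  \<open>H\<close>.\<close>

locale corner_pair = l: corner_embedding G K \<phi> + r: corner_embedding H K \<psi>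
  for G :: "'a top_groupoid" and H :: "'b top_groupoid" and K :: "'k top_groupoid" and \<phi> \<psi>
begin

abbreviation "S \<equiv> corner K (\<phi> ` units G) (\<psi> ` units H)"

abbreviation "Z \<equiv> subtopology (gtop K) S"

abbreviation "p k \<equiv> l.pull (grange K k)"

abbreviation "q k \<equiv> r.pull (gsource K k)"

lemma corner_pair_opposite: "corner_pair (opposite H) (opposite G) (opposite K) \<psi> \<phi>"
  by (intro corner_pair.intro l.corner_embedding_opposite r.corner_embedding_opposite)

lemma S_D:
  assumes "k \<in> S"
  shows "k \<in> arrows K" "grange K k \<in> \<phi> ` units G" "gsource K k \<in> \<psi> ` units H"
  using assms by (simp_all add: corner_def)

lemma topspace_Z: "topspace Z = S"
  by (auto simp: corner_def arrows_def)

lemma continuous_range_K: "continuous_map (gtop K) (gtop K) (grange K)"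
  and continuous_source_K: "continuous_map (gtop K) (gtop K) (gsource K)"
  using l.cod.continuous_range l.cod.continuous_source
  by (simp_all add: unit_space_def continuous_map_in_subtopology)

lemma open_S: "openin (gtop K) S"
proof -
  have "S = {k \<in> topspace (gtop K). grange K k \<in> \<phi> ` units G} \<inter> {k \<in> topspace (gtop K). gsource K k \<in> \<psi> ` units H}"
    by (auto simp: corner_def arrows_def)
  then show ?thesis
    using openin_continuous_map_preimage[OF continuous_range_K l.open_units]
      openin_continuous_map_preimage[OF continuous_source_K r.open_units] by auto
qed

lemma p_unit: "k \<in> S \<Longrightarrow> p k \<in> units G" and q_unit: "k \<in> S \<Longrightarrow> q k \<in> units H"
  by (simp_all add: l.pull_unit r.pull_unit S_D)

lemma map_p: "k \<in> S \<Longrightarrow> \<phi> (p k) = grange K k" and map_q: "k \<in> S \<Longrightarrow> \<psi> (q k) = gsource K k"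
  by (simp_all add: l.map_pull l.unit_in_corner r.map_pull r.unit_in_corner S_D)

lemma continuous_p: "continuous_map Z (unit_space G) p"
proof -
  have "continuous_map Z (subtopology (gtop K) (corner K (\<phi> ` units G) (\<phi> ` units G))) (grange K)"
    by (intro continuous_map_into_subtopology continuous_map_from_subtopology continuous_range_K)
      (auto simp: topspace_Z S_D l.unit_in_corner simp del: topspace_subtopology)
  from continuous_map_compose[OF this l.continuous_pull]
  have "continuous_map Z (gtop G) p" by (simp add: comp_def)
  then show ?thesis
    unfolding unit_space_def
    by (rule continuous_map_into_subtopology) (auto simp: topspace_Z p_unit simp del: topspace_subtopology)
qed

lemma continuous_q: "continuous_map Z (unit_space H) q"
proof -
  interpret op: corner_pair "opposite H" "opposite G" "opposite K" \<psi> \<phi> by (rule corner_pair_opposite)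
  have "op.l.pull = r.pull" by (simp add: op.l.pull_def r.pull_def)
  then show ?thesis using op.continuous_p by simp
qed

lemma dom_composable:
  "(g, z) \<in> left_dom G Z p \<Longrightarrow> (\<phi> g, z) \<in> composable K"
  by (auto simp: left_dom_def composable_def topspace_Z l.map_arrow l.map_source[symmetric] map_p S_D
      simp del: topspace_subtopology)

lemma left_domD:
  assumes "(g, z) \<in> left_dom G Z p"
  shows "g \<in> arrows G" "z \<in> S" "gsource G g = p z"
  using assms unfolding left_dom_def topspace_Z by auto

lemma act_in_S:
  assumes "(g, z) \<in> left_dom G Z p"
  shows "gmult K (\<phi> g) z \<in> S"
  using left_domD[OF assms] dom_composable[OF assms]
  by (auto simp: corner_def l.cod.mult_closed l.cod.range_mult l.cod.source_mult l.dom.range_unit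
      simp flip: l.map_range)

text \<open>Two arrows of \<open>S\<close> with a common source differ by \<open>a b^-1\<close>,
  which has both ends in the first corner and hence comes from \<open>G\<close>. This both describes
  the orbits and inverts the map that has to be proper.\<close>

lemma quotient_arrow:
  assumes "a \<in> S" "b \<in> S" "gsource K a = gsource K b"
  shows "(a, ginv K b) \<in> composable K"
    and "gmult K a (ginv K b) \<in> corner K (\<phi> ` units G) (\<phi> ` units G)"
    and "(l.pull (gmult K a (ginv K b)), b) \<in> left_dom G Z p"
    and "gmult K (\<phi> (l.pull (gmult K a (ginv K b)))) b = a"
proof -
  show c: "(a, ginv K b) \<in> composable K"
    using assms by (simp add: composable_def S_D l.cod.inv_closed l.cod.range_inv)
  show m: "gmult K a (ginv K b) \<in> corner K (\<phi> ` units G) (\<phi> ` units G)"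
    using assms c by (simp add: corner_def l.cod.mult_closed l.cod.range_mult l.cod.source_mult l.cod.source_inv)
  have "\<phi> (gsource G (l.pull (gmult K a (ginv K b)))) = grange K b"
    using c assms by (simp add: l.map_source l.pull_arrow l.map_pull m l.cod.source_mult l.cod.source_inv S_D)
  then have "gsource G (l.pull (gmult K a (ginv K b))) = p b"
    using l.pull_map[OF l.dom.source_closed[OF l.pull_arrow[OF m]]] by simp
  then show "(l.pull (gmult K a (ginv K b)), b) \<in> left_dom G Z p"
    using assms m by (simp add: left_dom_def topspace_Z l.pull_arrow del: topspace_subtopology)
  have "(ginv K b, b) \<in> composable K"
    using assms by (simp add: composable_def S_D l.cod.inv_closed l.cod.source_inv)
  then show "gmult K (\<phi> (l.pull (gmult K a (ginv K b)))) b = a"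
    using assms(1,2) by (simp add: l.map_pull m l.cod.mult_assoc c l.cod.mult_inv_left S_D
        l.cod.source_mult_right flip: assms(3))
qed

lemma act_inv:
  assumes "(g, z) \<in> left_dom G Z p"
  shows "gmult K (gmult K (\<phi> g) z) (ginv K z) = \<phi> g"
proof -
  note d = left_domD[OF assms]
  have "(z, ginv K z) \<in> composable K"
    using S_D[OF d(2)] by (simp add: composable_def l.cod.inv_closed l.cod.range_inv)
  then have "gmult K (gmult K (\<phi> g) z) (ginv K z) = gmult K (\<phi> g) (gmult K z (ginv K z))"
    by (simp add: l.cod.mult_assoc dom_composable[OF assms])
  also have "\<dots> = gmult K (\<phi> g) (gsource K (\<phi> g))"
    using dom_composable[OF assms] S_D[OF d(2)] by (simp add: l.cod.mult_inv_right composable_def)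
  finally show ?thesis by (simp add: l.cod.source_mult_right l.map_arrow d)
qed

lemma continuous_act:
  "continuous_map (left_dom_topology G Z p) (gtop K) (\<lambda>x. gmult K (\<phi> (fst x)) (snd x))"
proof -
  have 1: "continuous_map (left_dom_topology G Z p) (gtop K) (\<phi> \<circ> fst)"
    unfolding left_dom_topology_def
    by (rule continuous_map_compose[OF continuous_map_from_subtopology[OF continuous_map_fst] l.continuous_embedding])
  have 2: "continuous_map (left_dom_topology G Z p) Z snd"
    unfolding left_dom_topology_def by (intro continuous_map_from_subtopology continuous_map_snd)
  then have "continuous_map (left_dom_topology G Z p) (gtop K) snd"
    by (simp add: continuous_map_in_subtopology)
  with 1 have "continuous_map (left_dom_topology G Z p) (prod_topology (gtop K) (gtop K)) (\<lambda>x. ((\<phi> \<circ> fst) x, snd x))"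
    by (simp only: continuous_map_paired simp_thms)
  then have "continuous_map (left_dom_topology G Z p)
      (subtopology (prod_topology (gtop K) (gtop K)) (composable K)) (\<lambda>x. ((\<phi> \<circ> fst) x, snd x))"
    by (rule continuous_map_into_subtopology) (auto simp: left_dom_topology_def dom_composable)
  from continuous_map_compose[OF this l.cod.continuous_mult] show ?thesis by (simp add: comp_def)
qed

lemma topspace_left_dom: "topspace (left_dom_topology G Z p) = left_dom G Z p"
  by (auto simp: left_dom_topology_def left_dom_def arrows_def)

lemma left_action: "left_action G Z p (\<lambda>g z. gmult K (\<phi> g) z)"
  unfolding left_action_def
proof (intro conjI ballI)
  show "continuous_map Z (unit_space G) p" by (rule continuous_p)
  have "continuous_map (left_dom_topology G Z p) Z (\<lambda>x. gmult K (\<phi> (fst x)) (snd x))"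
    by (rule continuous_map_into_subtopology[OF continuous_act])
      (use act_in_S in \<open>auto simp: topspace_left_dom\<close>)
  then show "continuous_map (left_dom_topology G Z p) Z (\<lambda>(g, z). gmult K (\<phi> g) z)"
    by (simp add: case_prod_unfold)
next
  fix x assume x: "x \<in> left_dom G Z p"
  obtain g z where gz: "x = (g, z)" by (cases x)
  note d = left_domD[OF x[unfolded gz]]
  have "p (gmult K (\<phi> g) z) = l.pull (\<phi> (grange G g))"
    using l.cod.range_mult[OF dom_composable[OF x[unfolded gz]]] by (simp add: l.map_range d)
  then show "case x of (g, z) \<Rightarrow> p (gmult K (\<phi> g) z) = grange G g"
    by (simp add: gz l.pull_map l.dom.range_closed d)
next
  fix x assume x: "x \<in> composable G"
  obtain g h where gh: "x = (g, h)" by (cases x)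
  show "case x of (g, h) \<Rightarrow> \<forall>z. (h, z) \<in> left_dom G Z p \<longrightarrow>
      gmult K (\<phi> (gmult G g h)) z = gmult K (\<phi> g) (gmult K (\<phi> h) z)"
  proof (unfold gh case_prod_conv, intro allI impI)
    fix z assume z: "(h, z) \<in> left_dom G Z p"
    have "(\<phi> g, \<phi> h) \<in> composable K"
      using x by (simp add: gh l.map_composable)
    then show "gmult K (\<phi> (gmult G g h)) z = gmult K (\<phi> g) (gmult K (\<phi> h) z)"
      using x l.cod.mult_assoc[OF _ dom_composable[OF z]] by (simp add: gh l.map_mult)
  qed
next
  fix z assume "z \<in> topspace Z"
  then have "z \<in> S" by (simp only: topspace_Z)
  then show "gmult K (\<phi> (p z)) z = z" by (simp only: map_p l.cod.range_mult_left S_D)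
qed

lemma free_left_action: "free_left_action G Z p (\<lambda>g z. gmult K (\<phi> g) z)"
  unfolding free_left_action_def
proof clarify
  fix g z assume gz: "(g, z) \<in> left_dom G Z p" "gmult K (\<phi> g) z = z"
  note d = left_domD[OF gz(1)]
  have "\<phi> g = grange K z"
    using act_inv[OF gz(1)] S_D[OF d(2)] by (simp add: gz(2) l.cod.mult_inv_right)
  then have "\<phi> g = \<phi> (p z)" using map_p[OF d(2)] by simp
  then have "g = p z" using d(1) p_unit[OF d(2)] l.inj l.dom.units_iff by (meson inj_onD)
  then show "g \<in> units G" using p_unit[OF d(2)] by simp
qed

text \<open>The map is a homeomorphism onto the pairs with a common source, with inverse
  \<open>(a, b) -> (a b^-1, b)\<close> up to \<open>pull\<close>. Those pairs form a closed set
  because sources are compared in the Hausdorff unit space, even if \<open>K\<close> is not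
  Hausdorff.\<close>

lemma proper_left_action: "proper_left_action G Z p (\<lambda>g z. gmult K (\<phi> g) z)"
  unfolding proper_left_action_def
proof (rule proper_map_closed_embedding)
  let ?P = "prod_topology Z Z"
  let ?D = "{x \<in> topspace ?P. gsource K (fst x) = gsource K (snd x)}"
  let ?E = "subtopology ?P ?D"
  let ?f = "\<lambda>(g, z). (gmult K (\<phi> g) z, z)"
  let ?e = "\<lambda>(a, b). (l.pull (gmult K a (ginv K b)), b)"
  have sZ: "continuous_map Z (unit_space K) (gsource K)"
    by (rule continuous_map_from_subtopology[OF l.cod.continuous_source])
  show "closedin ?P ?D"
    using closedin_continuous_maps_eq[OF l.cod.Hausdorff_unit_space
        continuous_map_compose[OF continuous_map_fst sZ] continuous_map_compose[OF continuous_map_snd sZ]]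
    by (simp add: comp_def)
  have D: "(a, b) \<in> ?D \<longleftrightarrow> a \<in> S \<and> b \<in> S \<and> gsource K a = gsource K b" for a b
    by (simp add: topspace_Z del: topspace_subtopology)
  have tE: "topspace ?E = ?D" by auto
  have fD: "?f x \<in> ?D" if x: "x \<in> left_dom G Z p" for x
  proof -
    obtain g z where gz: "x = (g, z)" by (cases x)
    show ?thesis
      using act_in_S[OF x[unfolded gz]] left_domD[OF x[unfolded gz]]
        l.cod.source_mult[OF dom_composable[OF x[unfolded gz]]]
      unfolding gz case_prod_conv D by simp
  qed
  have "homeomorphic_maps (left_dom_topology G Z p) ?E ?f ?e"
    unfolding homeomorphic_maps_def
  proof (intro conjI ballI)
    have "continuous_map (left_dom_topology G Z p) Z (\<lambda>x. gmult K (\<phi> (fst x)) (snd x))"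
      by (rule continuous_map_into_subtopology[OF continuous_act])
        (use act_in_S in \<open>auto simp: topspace_left_dom\<close>)
    moreover have "continuous_map (left_dom_topology G Z p) Z snd"
      unfolding left_dom_topology_def by (intro continuous_map_from_subtopology continuous_map_snd)
    ultimately have "continuous_map (left_dom_topology G Z p) ?P ?f"
      unfolding case_prod_unfold by (rule continuous_map_pairedI)
    then show "continuous_map (left_dom_topology G Z p) ?E ?f"
      by (rule continuous_map_into_subtopology) (use fD in \<open>auto simp only: topspace_left_dom\<close>)
    have c1: "continuous_map ?E Z fst" and c2: "continuous_map ?E Z snd"
      by (rule continuous_map_from_subtopology, rule continuous_map_fst)
        (rule continuous_map_from_subtopology, rule continuous_map_snd)
    have c1': "continuous_map ?E (gtop K) fst" and c2': "continuous_map ?E (gtop K) snd"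
      using c1 c2 unfolding continuous_map_in_subtopology[of ?E "gtop K"] by blast+
    have "continuous_map ?E (prod_topology (gtop K) (gtop K)) (\<lambda>x. (fst x, (ginv K \<circ> snd) x))"
      by (rule continuous_map_pairedI[OF c1' continuous_map_compose[OF c2' l.cod.continuous_inv]])
    then have "continuous_map ?E (subtopology (prod_topology (gtop K) (gtop K)) (composable K))
        (\<lambda>x. (fst x, (ginv K \<circ> snd) x))"
    proof (rule continuous_map_into_subtopology, intro funcsetI)
      fix x assume "x \<in> topspace ?E"
      then obtain a b where "x = (a, b)" "(a, b) \<in> ?D" unfolding tE by (cases x) simp
      then show "(fst x, (ginv K \<circ> snd) x) \<in> composable K"
        using quotient_arrow(1) unfolding D by simp
    qed
    from continuous_map_compose[OF this l.cod.continuous_mult]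
    have "continuous_map ?E (gtop K) (\<lambda>x. gmult K (fst x) (ginv K (snd x)))" by (simp add: comp_def)
    then have "continuous_map ?E (subtopology (gtop K) (corner K (\<phi> ` units G) (\<phi> ` units G)))
        (\<lambda>x. gmult K (fst x) (ginv K (snd x)))"
    proof (rule continuous_map_into_subtopology, intro funcsetI)
      fix x assume "x \<in> topspace ?E"
      then obtain a b where "x = (a, b)" "(a, b) \<in> ?D" unfolding tE by (cases x) simp
      then show "gmult K (fst x) (ginv K (snd x)) \<in> corner K (\<phi> ` units G) (\<phi> ` units G)"
        using quotient_arrow(2) unfolding D by simp
    qed
    from continuous_map_compose[OF this l.continuous_pull]
    have "continuous_map ?E (gtop G) (\<lambda>x. l.pull (gmult K (fst x) (ginv K (snd x))))" by (simp add: comp_def)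
    from continuous_map_pairedI[OF this c2]
    have "continuous_map ?E (prod_topology (gtop G) Z) ?e" by (simp add: case_prod_unfold)
    then show "continuous_map ?E (left_dom_topology G Z p) ?e"
      unfolding left_dom_topology_def
    proof (rule continuous_map_into_subtopology, intro funcsetI)
      fix x assume "x \<in> topspace ?E"
      then obtain a b where "x = (a, b)" "(a, b) \<in> ?D" unfolding tE by (cases x) simp
      then show "?e x \<in> left_dom G Z p"
        using quotient_arrow(3) unfolding D by simp
    qed
    show "?e (?f x) = x" if x: "x \<in> topspace (left_dom_topology G Z p)" for x
    proof -
      obtain g z where gz: "x = (g, z)" "(g, z) \<in> left_dom G Z p"
        using x unfolding topspace_left_dom by (cases x) simp
      show ?thesis using act_inv[OF gz(2)] l.pull_map[OF left_domD(1)[OF gz(2)]] by (simp add: gz(1))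
    qed
    show "?f (?e x) = x" if x: "x \<in> topspace ?E" for x
    proof -
      obtain a b where ab: "x = (a, b)" "(a, b) \<in> ?D" using x unfolding tE by (cases x) simp
      show ?thesis using quotient_arrow(4) ab(2) unfolding D by (simp add: ab(1))
    qed
  qed
  then show "homeomorphic_map (left_dom_topology G Z p) ?E ?f"
    by (rule homeomorphic_maps_imp_map)
qed

lemma q_act: "(g, z) \<in> left_dom G Z p \<Longrightarrow> q (gmult K (\<phi> g) z) = q z"
  using l.cod.source_mult[OF dom_composable] by simp

lemma q_eq_iff: "\<lbrakk>a \<in> S; b \<in> S\<rbrakk> \<Longrightarrow> q a = q b \<longleftrightarrow> gsource K a = gsource K b"
  using map_q by metis

lemma left_orbit_eq:
  assumes "z \<in> S"
  shows "left_orbit G Z p (\<lambda>g z. gmult K (\<phi> g) z) z = {w \<in> S. q w = q z}"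
proof
  show "left_orbit G Z p (\<lambda>g z. gmult K (\<phi> g) z) z \<subseteq> {w \<in> S. q w = q z}"
    unfolding left_orbit_def using act_in_S q_act by blast
  show "{w \<in> S. q w = q z} \<subseteq> left_orbit G Z p (\<lambda>g z. gmult K (\<phi> g) z) z"
  proof clarify
    fix w assume w: "w \<in> S" "q w = q z"
    then have "gsource K w = gsource K z" using q_eq_iff assms by blast
    from quotient_arrow(3,4)[OF w(1) assms this]
    show "w \<in> left_orbit G Z p (\<lambda>g z. gmult K (\<phi> g) z) z"
      unfolding left_orbit_def by force
  qed
qed

text \<open>\<open>q\<close> inherits openness from the source map of \<open>K\<close>, as
  \<open>S\<close> is open in \<open>K\<close>. It is onto because the first corner is full, and its
  fibres are the orbits by \<open>left_orbit_eq\<close>.\<close>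

lemma left_quotient: "induces_homeomorphism Z (left_orbit G Z p (\<lambda>g z. gmult K (\<phi> g) z)) (unit_space H) q"
  unfolding induces_homeomorphism_iff
proof (intro conjI ballI)
  show "quotient_map Z (unit_space H) q"
  proof (rule continuous_open_imp_quotient_map)
    show "continuous_map Z (unit_space H) q" by (rule continuous_q)
    show "open_map Z (unit_space H) q"
      unfolding open_map_def
    proof (intro allI impI)
      fix U assume U: "openin Z U"
      have US: "U \<subseteq> S" using openin_subset[OF U] by (simp only: topspace_Z)
      have "openin (gtop K) U" using openin_trans_full[OF U open_S] .
      then have "openin (unit_space K) (gsource K ` U)"
        using local_homeomorphism_imp_open_map[OF l.cod.local_homeomorphism_source] by (simp add: open_map_def)
      then have o: "openin (gtop K) (gsource K ` U)"
        unfolding unit_space_def using openin_trans_full[OF _ l.cod.openin_units] by blast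
      have "continuous_map (unit_space H) (gtop K) \<psi>"
        unfolding unit_space_def by (rule continuous_map_from_subtopology[OF r.continuous_embedding])
      from openin_continuous_map_preimage[OF this o]
      have "openin (unit_space H) {y \<in> units H. \<psi> y \<in> gsource K ` U}"
        by (simp add: r.dom.topspace_unit_space)
      moreover have "q ` U = {y \<in> units H. \<psi> y \<in> gsource K ` U}"
      proof
        show "q ` U \<subseteq> {y \<in> units H. \<psi> y \<in> gsource K ` U}"
          using US q_unit map_q by fastforce
        show "{y \<in> units H. \<psi> y \<in> gsource K ` U} \<subseteq> q ` U"
        proof clarify
          fix y u assume y: "y \<in> units H" "\<psi> y = gsource K u" "u \<in> U"
          then have "q u = y" using r.pull_map r.dom.units_iff by metis
          then show "y \<in> q ` U" using y(3) by blast
        qed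
      qed
      ultimately show "openin (unit_space H) (q ` U)" by simp
    qed
    show "q ` topspace Z = topspace (unit_space H)"
      unfolding topspace_Z r.dom.topspace_unit_space
    proof
      show "q ` S \<subseteq> units H" using q_unit by blast
      show "units H \<subseteq> q ` S"
      proof
        fix y assume y: "y \<in> units H"
        then have "\<psi> y \<in> units K" by (intro r.map_unit) simp
        then obtain k where k: "k \<in> arrows K" "grange K k \<in> \<phi> ` units G" "gsource K k = \<psi> y"
          using l.full by metis
        then have "k \<in> S" using y by (simp add: corner_def)
        moreover have "q k = y" using k(3) y r.pull_map r.dom.units_iff by simp
        ultimately show "y \<in> q ` S" by blast
      qed
    qed
  qed
  fix x y assume "x \<in> topspace Z" "y \<in> topspace Z"
  then have xy: "x \<in> S" "y \<in> S" by (simp_all only: topspace_Z)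
  then show "q x = q y \<longleftrightarrow> left_orbit G Z p (\<lambda>g z. gmult K (\<phi> g) z) x = left_orbit G Z p (\<lambda>g z. gmult K (\<phi> g) z) y"
    unfolding left_orbit_eq[OF xy(1)] left_orbit_eq[OF xy(2)] by auto
qed

theorem corner_equivalence:
  "groupoid_equivalence G H Z p q (\<lambda>g z. gmult K (\<phi> g) z) (\<lambda>z h. gmult K z (\<psi> h))"
proof -
  interpret op: corner_pair "opposite H" "opposite G" "opposite K" \<psi> \<phi> by (rule corner_pair_opposite)
  have pull: "op.l.pull = r.pull" "op.r.pull = l.pull"
    by (simp_all add: op.l.pull_def r.pull_def op.r.pull_def l.pull_def)
  have H: "groupoid H" by (rule r.dom.groupoid_axioms)
  note op_simps = opposite_simps corner_opposite pull l.dom.units_opposite r.dom.units_opposite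
    l.dom.unit_space_opposite
  note op_facts = op.left_action op.free_left_action op.proper_left_action op.left_quotient
  have R: "right_action H Z q (\<lambda>z h. gmult K z (\<psi> h))" "free_right_action H Z q (\<lambda>z h. gmult K z (\<psi> h))"
    "proper_right_action H Z q (\<lambda>z h. gmult K z (\<psi> h))"
    "induces_homeomorphism Z (right_orbit H Z q (\<lambda>z h. gmult K z (\<psi> h))) (unit_space G) p"
    using op_facts unfolding op_simps
      left_action_opposite[OF H, of _ _ "\<lambda>z h. gmult K z (\<psi> h)"]
      free_left_action_opposite[OF H, of _ _ "\<lambda>z h. gmult K z (\<psi> h)"]
      proper_left_action_opposite[of _ _ _ "\<lambda>z h. gmult K z (\<psi> h)"]
      left_orbit_opposite[of _ _ _ "\<lambda>z h. gmult K z (\<psi> h)"]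
    by blast+
  have rd: "(z, \<psi> h) \<in> composable K" if "(z, h) \<in> right_dom H Z q" for z h
    using op.dom_composable[of h z] that unfolding op_simps by simp
  have "p (gmult K z (\<psi> h)) = p z" if "(z, h) \<in> right_dom H Z q" for z h
    using l.cod.range_mult[OF rd[OF that]] by simp
  moreover have "gmult K (gmult K (\<phi> g) z) (\<psi> h) = gmult K (\<phi> g) (gmult K z (\<psi> h))"
    if "(g, z) \<in> left_dom G Z p" "(z, h) \<in> right_dom H Z q" for g z h
    by (rule l.cod.mult_assoc[OF dom_composable[OF that(1)] rd[OF that(2)]])
  ultimately show ?thesis
    unfolding groupoid_equivalence_def
    using left_action free_left_action proper_left_action R left_quotient q_act by blast
qed

end

section \<open>The level 0 corner and the two implications\<close>

lemma corner_embedding_stabilization: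
  assumes "ample_groupoid G"
  shows "corner_embedding G (prod_groupoid G full_relation) (\<lambda>g. (g, 0, 0))"
proof -
  interpret G: ample_groupoid G by fact
  interpret P: ample_groupoid "prod_groupoid G full_relation"
    by (rule ample_groupoid_prod_groupoid[OF assms ample_groupoid_full_relation])
  let ?K = "prod_groupoid G full_relation"
  have ar: "arrows ?K = arrows G \<times> UNIV"
    by (simp add: arrows_prod_groupoid) (simp add: arrows_def full_relation_def)
  have crn: "corner ?K ((\<lambda>g. (g, 0, 0)) ` units G) ((\<lambda>g. (g, 0, 0)) ` units G) = arrows G \<times> {(0, 0)}"
    unfolding corner_def ar
    by (auto simp: prod_groupoid_def full_relation_def G.range_unit G.source_unit)
  have im: "(\<lambda>g. (g, 0, 0)) ` units G = units G \<times> {(0, 0)}" by auto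
  show ?thesis
  proof
    have "homeomorphic_maps (gtop G) (subtopology (gtop ?K) (arrows G \<times> {(0, 0)})) (\<lambda>g. (g, 0, 0)) fst"
      unfolding homeomorphic_maps_def
      by (auto intro!: continuous_map_into_subtopology continuous_map_pairedI
          intro: continuous_map_from_subtopology continuous_map_fst
          simp: prod_groupoid_def full_relation_def arrows_def)
    then show "homeomorphic_map (gtop G) (subtopology (gtop ?K)
        (corner ?K ((\<lambda>g. (g, 0, 0)) ` units G) ((\<lambda>g. (g, 0, 0)) ` units G))) (\<lambda>g. (g, 0, 0))"
      unfolding crn by (rule homeomorphic_maps_imp_map)
    show "openin (gtop ?K) ((\<lambda>g. (g, 0, 0)) ` units G)"
      unfolding im using G.openin_units by (simp add: prod_groupoid_def full_relation_def openin_prod_Times_iff)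
    fix x assume "x \<in> units ?K"
    then obtain g i j where g: "g \<in> arrows G" "x = grange ?K (g, i, j)"
      unfolding units_def[of ?K] ar by auto
    then have x: "grange G g \<in> units G" "x = (grange G g, i, i)"
      by (simp_all add: prod_groupoid_def full_relation_def G.range_unit)
    then show "\<exists>k\<in>arrows ?K. grange ?K k \<in> (\<lambda>g. (g, 0, 0)) ` units G \<and> gsource ?K k = x"
      \<comment> \<open>The arrow with levels \<open>(0, i)\<close> over the unit
        \<open>grange G g\<close> connects level \<open>i\<close> with level 0.\<close>
      unfolding ar by (intro bexI[of _ "(grange G g, 0, i)"])
        (auto simp: prod_groupoid_def full_relation_def g(1) G.range_closed G.range_range G.source_range)
  qed (simp_all add: prod_groupoid_def full_relation_def)
qed

theorem theorem2p1:
  fixes G :: "'a top_groupoid" and H :: "'b top_groupoid"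
  assumes "ample_groupoid G" and "ample_groupoid H"
    and "sigma_compact_space (unit_space G)" and "sigma_compact_space (unit_space H)"
  shows "groupoid_equivalent G H \<longleftrightarrow>
    groupoid_isomorphic (prod_groupoid G full_relation) (prod_groupoid H full_relation)"
proof
  assume "groupoid_equivalent G H"
  then obtain Z :: "('a \<times> 'b) topology" and p q l r where "groupoid_equivalence G H Z p q l r"
    unfolding groupoid_equivalent_def by blast
  with assms have "ample_equivalence G H Z p q l r"
    by (intro ample_equivalence.intro ample_equivalence_axioms.intro)
  then show "groupoid_isomorphic (prod_groupoid G full_relation) (prod_groupoid H full_relation)"
    using assms(3,4) by (rule ample_equivalence.stable_isomorphism)
next
  assume "groupoid_isomorphic (prod_groupoid G full_relation) (prod_groupoid H full_relation)"
  then obtain f where f: "groupoid_isomorphism (prod_groupoid G full_relation) (prod_groupoid H full_relation) f"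
    unfolding groupoid_isomorphic_def by blast
  have H: "ample_groupoid (prod_groupoid H full_relation)"
    by (rule ample_groupoid_prod_groupoid[OF assms(2) ample_groupoid_full_relation])
  \<comment> \<open>Both corners sit at level 0 of their own stabilization; the one of
    \<open>G\<close> is carried over by \<open>f\<close>.\<close>
  have "corner_pair G H (prod_groupoid H full_relation) (f \<circ> (\<lambda>g. (g, 0, 0))) (\<lambda>h. (h, 0, 0))"
    by (intro corner_pair.intro corner_embedding.corner_embedding_isomorphism[OF _ H f]
        corner_embedding_stabilization assms(1,2))
  \<comment> \<open>The space of this equivalence is made of arrows of the stabilization of
    \<open>H\<close>; \<open>groupoid_equivalentI\<close> moves it to the type fixed in the
    definition.\<close>
  from corner_pair.corner_equivalence[OF this] show "groupoid_equivalent G H"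
    by (rule groupoid_equivalentI[OF ample_groupoid.axioms(1)[OF assms(2)]])
qed

end
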